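(* For every $n\in\mathbb{N}$ and $\lambda\in\mathbb{R}$, the $n$-th limit moment $m_n(\lambda)=\lim_{N\to\infty}\varphi\big(S_N(\lambda)^n\big)$ is given by $$m_n(\lambda)=\sum_{k=0}^{\lfloor n/2\rfloor}\frac{|\mathcal{OV}^{2+}(n,k)|}{k!}\,\lambda^{n-2k}.$$
   Context: Notation: $\mathbb{N}=\{0,1,2,\dots\}$, $[n]=\{1,\dots,n\}$, $[0]=\emptyset$; $\lambda^0=1$ for all $\lambda$, including $\lambda=0$. Operators. A finite word $(i_1,\dots,i_n)$ over $\mathbb{N}$ is a V-word if $n=0$ or there is $m\in[n]$ with $i_1>\dots>i_m<\dots<i_n$; let $\mathcal{V}$ be the set of V-words. The discrete V-monotone Fock space $\mathcal{F}$ is the complex Hilbert space with orthonormal basis $(e_w)_{w\in\mathcal V}$; $\Omega=e_{()}$ is the vacuum vector, and $e_w=0$ for words $w\notin\mathcal V$. For $i\in\mathbb{N}$ the bounded operators $A_i^+,A_i^-,A_i^\circ$ on $\mathcal F$ (creation, annihilation, conservation) are determined by: $A_i^+e_w=e_{(i,w)}$ (concatenation) for $w\in\mathcal V$; $A_i^-\Omega=A_i^\circ\Omega=0$; and for $w=(j,w_0)\in\mathcal V$, $A_i^-e_w=\delta_{i,j}e_{w_0}$ and $A_i^\circ e_w=\delta_{i,j}e_w$. The vacuum state is $\varphi(b)=\langle b\,\Omega,\Omega\rangle$. For $N\ge1$ put $$S_N(\lambda)=\sum_{i=1}^N\Big(\frac{A_i^++A_i^-}{\sqrt N}+\lambda A_i^\circ\Big).$$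 Partitions. $\mathcal{NC}^{2+}(n)$ is the set of noncrossing partitions of $[n]$ all of whose blocks have at least two elements ($\mathcal{NC}^{2+}(0)=\{\emptyset\}$). For blocks $B,B'$ of $\pi$ write $B'\prec_\pi B$ if $B$ lies strictly between two consecutive elements of $B'$, i.e. $l_{q-1}<\min B\le\max B<l_q$ for some $q\in[p]$, where $B'=\{l_0<\dots<l_p\}$. A labeled partition is a pair $(\pi,\mathrm L)$ with $\mathrm L$ a function on the blocks of $\pi$ with values in $\mathbb{N}$; it is V-monotonically labeled if for every maximal chain $B_1\prec_\pi\dots\prec_\pi B_r$ of $(\pi,\prec_\pi)$ the word $(\mathrm L(B_r),\dots,\mathrm L(B_1))$ is a V-word. An ordered partition is a sequence of distinct blocks $(B_1,\dots,B_k)$ such that $\{B_1,\dots,B_k\}$ is a partition; it is identified with the labeled partition in which $B_j$ has label $j$. $\mathcal{OV}^{2+}(n,k)$ is the set of ordered partitions $(B_1,\dots,B_k)$ with exactly $k$ blocks such that $\{B_1,\dots,B_k\}\in\mathcal{NC}^{2+}(n)$ and the labeling $B_j\mapsto j$ is V-monotone. In particular $|\mathcal{OV}^{2+}(0,0)|=1$. *)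

theory Defs
  imports "HOL-Analysis.Analysis" "HOL-Library.Disjoint_Sets"
begin

section \<open>V-words and the discrete V-monotone Fock space\<close>

text \<open>With \<open>w = [i\<^sub>1, \<dots>, i\<^sub>n]\<close>, the witness \<open>m\<close> is the position of the minimum in
  \<open>i\<^sub>1 > \<dots> > i\<^sub>m < \<dots> < i\<^sub>n\<close>; the letter \<open>i\<^sub>m\<close> belongs to both sublists.\<close>

definition v_word :: "nat list \<Rightarrow> bool" where
  "v_word w \<longleftrightarrow> w = [] \<or>
     (\<exists>m\<in>{1..length w}. sorted_wrt (>) (take m w) \<and> sorted_wrt (<) (drop (m - 1) w))"

lemma v_word_Nil [simp]: "v_word []"
  by (simp add: v_word_def)

lemma v_word_ConsD: "v_word w" if "v_word (i # w)"
proof (cases "w = []")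
  case False
  obtain m where m: "m \<in> {1..Suc (length w)}" "sorted_wrt (>) (take m (i # w))"
    "sorted_wrt (<) (drop (m - 1) (i # w))"
    using \<open>v_word (i # w)\<close> by (auto simp: v_word_def)
  show ?thesis
  proof (cases "m = 1")
    case True
    then have "sorted_wrt (<) w" using m by simp
    moreover have "sorted_wrt (>) (take 1 w)" by (cases w) auto
    ultimately show ?thesis using False unfolding v_word_def
      by (intro disjI2 bexI[of _ 1]) (auto simp: Suc_le_eq)
  next
    case m1: False
    then obtain k where k: "m = Suc (Suc k)" using m(1) by (cases m; cases "m - 1") auto
    show ?thesis unfolding v_word_def
      by (intro disjI2 bexI[of _ "Suc k"]) (use m k in auto)
  qed
qed simp

text \<open>The Hilbert space with orthonormal basis indexed by the V-words is realised as the
  space of square-summable coefficient families, extended by \<open>0\<close> to all words.\<close>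

typedef fock = "{f :: nat list \<Rightarrow> complex.
    (\<lambda>w. (cmod (f w))\<^sup>2) summable_on UNIV \<and> (\<forall>w. \<not> v_word w \<longrightarrow> f w = 0)}"
  morphisms coef Abs_fock
  by (rule exI[of _ "\<lambda>_. 0"]) simp

setup_lifting type_definition_fock

lemma coef_square_summable: "(\<lambda>w. (cmod (coef f w))\<^sup>2) summable_on UNIV"
  using coef[of f] by simp

lemma coef_outside: "\<not> v_word w \<Longrightarrow> coef f w = 0"
  using coef[of f] by simp

lemma fock_eqI: "(\<And>w. coef f w = coef g w) \<Longrightarrow> f = g"
  by transfer auto

lemma square_summable_add:
  fixes f g :: "'a \<Rightarrow> complex"
  assumes "(\<lambda>w. (cmod (f w))\<^sup>2) summable_on A" "(\<lambda>w. (cmod (g w))\<^sup>2) summable_on A"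
  shows "(\<lambda>w. (cmod (f w + g w))\<^sup>2) summable_on A"
proof (rule summable_on_comparison_test)
  show "(\<lambda>w. 2 * (cmod (f w))\<^sup>2 + 2 * (cmod (g w))\<^sup>2) summable_on A"
    by (intro summable_on_add summable_on_cmult_right assms)
  fix w
  have "(cmod (f w + g w))\<^sup>2 \<le> (cmod (f w) + cmod (g w))\<^sup>2"
    by (intro power_mono norm_triangle_ineq) auto
  also have "\<dots> \<le> 2 * (cmod (f w))\<^sup>2 + 2 * (cmod (g w))\<^sup>2"
    using sum_squares_bound[of "cmod (f w)" "cmod (g w)"] by (simp add: power2_sum)
  finally show "(cmod (f w + g w))\<^sup>2 \<le> 2 * (cmod (f w))\<^sup>2 + 2 * (cmod (g w))\<^sup>2" .
qed auto

lemma square_summable_scale: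
  fixes f :: "'a \<Rightarrow> complex"
  assumes "(\<lambda>w. (cmod (f w))\<^sup>2) summable_on A"
  shows "(\<lambda>w. (cmod (c * f w))\<^sup>2) summable_on A"
  using summable_on_cmult_right[OF assms, of "(cmod c)\<^sup>2"]
  by (simp add: norm_mult power_mult_distrib)

lift_definition scaleC :: "complex \<Rightarrow> fock \<Rightarrow> fock" is "\<lambda>c f w. c * f w"
  by (auto intro: square_summable_scale)

text \<open>Linear in the first argument.\<close>

definition cinner :: "fock \<Rightarrow> fock \<Rightarrow> complex" where
  "cinner f g = (\<Sum>\<^sub>\<infinity>w. coef f w * cnj (coef g w))"

lemma cinner_summable: "(\<lambda>w. coef f w * cnj (coef g w)) summable_on UNIV"
proof -
  have "(\<lambda>w. norm (coef f w * cnj (coef g w))) summable_on UNIV"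
  proof (rule summable_on_comparison_test)
    show "(\<lambda>w. (cmod (coef f w))\<^sup>2 + (cmod (coef g w))\<^sup>2) summable_on UNIV"
      by (intro summable_on_add coef_square_summable)
    fix w
    have "cmod (coef f w) * cmod (coef g w) \<le> 2 * cmod (coef f w) * cmod (coef g w)" by simp
    also have "\<dots> \<le> (cmod (coef f w))\<^sup>2 + (cmod (coef g w))\<^sup>2"
      using sum_squares_bound by blast
    finally show "norm (coef f w * cnj (coef g w)) \<le> (cmod (coef f w))\<^sup>2 + (cmod (coef g w))\<^sup>2"
      by (simp add: norm_mult)
  qed auto
  then show ?thesis by (rule abs_summable_summable)
qed

text \<open>The real structure underlying the complex Hilbert space (real part of the inner
  product) provides the norm and the topology.\<close>

instantiation fock :: real_inner
begin

lift_definition zero_fock :: fock is "\<lambda>_. 0" by simp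
lift_definition plus_fock :: "fock \<Rightarrow> fock \<Rightarrow> fock" is "\<lambda>f g w. f w + g w"
  by (auto intro: square_summable_add)
lift_definition uminus_fock :: "fock \<Rightarrow> fock" is "\<lambda>f w. - f w" by simp
definition minus_fock :: "fock \<Rightarrow> fock \<Rightarrow> fock" where "minus_fock f g = f + (- g)"
definition scaleR_fock :: "real \<Rightarrow> fock \<Rightarrow> fock" where "scaleR_fock r = scaleC (of_real r)"
definition inner_fock :: "fock \<Rightarrow> fock \<Rightarrow> real" where "inner_fock f g = Re (cinner f g)"
definition norm_fock :: "fock \<Rightarrow> real" where "norm_fock f = sqrt (inner f f)"
definition dist_fock :: "fock \<Rightarrow> fock \<Rightarrow> real" where "dist_fock f g = norm (f - g)"
definition sgn_fock :: "fock \<Rightarrow> fock" where "sgn_fock f = inverse (norm f) *\<^sub>R f"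
definition uniformity_fock :: "(fock \<times> fock) filter" where
  "uniformity_fock = (INF e\<in>{0<..}. principal {(f, g). dist f g < e})"
definition open_fock :: "fock set \<Rightarrow> bool" where
  "open_fock U \<longleftrightarrow> (\<forall>f\<in>U. eventually (\<lambda>(f', g). f' = f \<longrightarrow> g \<in> U) uniformity)"

lemma inner_fock_self: "inner f f = (\<Sum>\<^sub>\<infinity>w. (cmod (coef f w))\<^sup>2)" for f :: fock
proof -
  have "Re (coef f w * cnj (coef f w)) = (cmod (coef f w))\<^sup>2" for w
    by (simp add: complex_mult_cnj cmod_power2)
  then show ?thesis
    using infsum_Re[OF cinner_summable[of f f]] by (simp add: inner_fock_def cinner_def)
qed

instance
proof
  fix f g h :: fock and r s :: real
  show "f + g + h = f + (g + h)" by transfer (simp add: add.assoc)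
  show "f + g = g + f" by transfer (simp add: add.commute)
  show "0 + f = f" by transfer simp
  show "- f + f = 0" by transfer simp
  show "f - g = f + - g" by (simp add: minus_fock_def)
  show "r *\<^sub>R (f + g) = r *\<^sub>R f + r *\<^sub>R g"
    unfolding scaleR_fock_def by transfer (simp add: algebra_simps)
  show "(r + s) *\<^sub>R f = r *\<^sub>R f + s *\<^sub>R f"
    unfolding scaleR_fock_def by transfer (simp add: algebra_simps)
  show "r *\<^sub>R s *\<^sub>R f = (r * s) *\<^sub>R f"
    unfolding scaleR_fock_def by transfer (simp add: algebra_simps)
  show "1 *\<^sub>R f = f" unfolding scaleR_fock_def by transfer simp
  show "sgn f = inverse (norm f) *\<^sub>R f" by (rule sgn_fock_def)
  show "dist f g = norm (f - g)" by (rule dist_fock_def)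
  show "norm f = sqrt (inner f f)" by (rule norm_fock_def)
  show "(uniformity :: (fock \<times> fock) filter) = (INF e\<in>{0<..}. principal {(f, g). dist f g < e})"
    by (rule uniformity_fock_def)
  show "open U \<longleftrightarrow> (\<forall>f\<in>U. eventually (\<lambda>(f', g). f' = f \<longrightarrow> g \<in> U) uniformity)"
    for U :: "fock set"
    by (rule open_fock_def)
  have "cinner f g = cnj (cinner g f)"
    unfolding cinner_def by (simp flip: infsum_cnj add: mult.commute)
  then show "inner f g = inner g f" by (simp add: inner_fock_def)
  have "cinner (f + g) h = cinner f h + cinner g h"
    unfolding cinner_def plus_fock.rep_eq distrib_right
    by (rule infsum_add) (rule cinner_summable)+
  then show "inner (f + g) h = inner f h + inner g h" by (simp add: inner_fock_def)
  have "cinner (scaleC c f) g = c * cinner f g" for c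
    unfolding cinner_def scaleC.rep_eq mult.assoc by (rule infsum_cmult_right')
  then show "inner (r *\<^sub>R f) g = r * inner f g" by (simp add: inner_fock_def scaleR_fock_def)
  show "0 \<le> inner f f" unfolding inner_fock_self by (rule infsum_nonneg) simp
  show "inner f f = 0 \<longleftrightarrow> f = 0"
  proof
    assume "inner f f = 0"
    then have "(cmod (coef f w))\<^sup>2 = 0" for w
      unfolding inner_fock_self
      using nonneg_infsum_le_0D[of "\<lambda>w. (cmod (coef f w))\<^sup>2" UNIV w] coef_square_summable[of f]
      by simp
    then show "f = 0" by (intro fock_eqI) (simp add: zero_fock.rep_eq)
  next
    assume "f = 0"
    then show "inner f f = 0" by (simp add: inner_fock_self zero_fock.rep_eq)
  qed
qed

end

lemma coef_simps [simp]:
  "coef 0 w = 0" "coef (f + g) w = coef f w + coef g w" "coef (- f) w = - coef f w"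
  "coef (f - g) w = coef f w - coef g w" "coef (scaleC c f) w = c * coef f w"
  "coef (r *\<^sub>R f) w = of_real r * coef f w"
  unfolding minus_fock_def scaleR_fock_def
  by (simp_all only: zero_fock.rep_eq plus_fock.rep_eq uminus_fock.rep_eq scaleC.rep_eq
      diff_conv_add_uminus)

lemma coef_sum: "coef (\<Sum>i\<in>I. f i) w = (\<Sum>i\<in>I. coef (f i) w)"
  by (induction I rule: infinite_finite_induct) auto

lemma norm_fock_power2: "(norm f)\<^sup>2 = (\<Sum>\<^sub>\<infinity>w. (cmod (coef f w))\<^sup>2)" for f :: fock
  using inner_fock_self[of f] by (simp only: power2_norm_eq_inner)

lemma sum_coef_le_norm: "finite F \<Longrightarrow> (\<Sum>w\<in>F. (cmod (coef f w))\<^sup>2) \<le> (norm f)\<^sup>2"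
  unfolding norm_fock_power2
  by (rule finite_sum_le_infsum) (auto intro: coef_square_summable)

lemma cmod_coef_le_norm: "cmod (coef f w) \<le> norm f"
  by (rule power2_le_imp_le) (use sum_coef_le_norm[of "{w}" f] in simp_all)

instance fock :: complete_space
proof
  fix X :: "nat \<Rightarrow> fock"
  assume X: "Cauchy X"
  have "Cauchy (\<lambda>n. coef (X n) w)" for w
  proof (rule metric_CauchyI)
    fix e :: real assume "0 < e"
    then obtain M where M: "\<And>m n. m \<ge> M \<Longrightarrow> n \<ge> M \<Longrightarrow> dist (X m) (X n) < e"
      using metric_CauchyD[OF X] by blast
    have "dist (coef (X m) w) (coef (X n) w) < e" if "m \<ge> M" "n \<ge> M" for m n
      using cmod_coef_le_norm[of "X m - X n" w] M[OF that] by (simp add: dist_norm)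
    then show "\<exists>M. \<forall>m\<ge>M. \<forall>n\<ge>M. dist (coef (X m) w) (coef (X n) w) < e" by blast
  qed
  then have "\<exists>l. (\<lambda>n. coef (X n) w) \<longlonglongrightarrow> l" for w
    using Cauchy_convergent convergent_def by blast
  then obtain L where L: "\<And>w. (\<lambda>n. coef (X n) w) \<longlonglongrightarrow> L w" by metis
  have bound: "(\<Sum>w\<in>F. (cmod (L w - coef (X n) w))\<^sup>2) \<le> e\<^sup>2"
    if "finite F" "\<And>m. m \<ge> n \<Longrightarrow> dist (X m) (X n) \<le> e" for F n e
  proof (rule tendsto_upperbound)
    show "(\<lambda>m. \<Sum>w\<in>F. (cmod (coef (X m) w - coef (X n) w))\<^sup>2) \<longlonglongrightarrow>
      (\<Sum>w\<in>F. (cmod (L w - coef (X n) w))\<^sup>2)"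
      by (intro tendsto_intros L)
    have "(\<Sum>w\<in>F. (cmod (coef (X m) w - coef (X n) w))\<^sup>2) \<le> e\<^sup>2" if "m \<ge> n" for m
    proof -
      have "(\<Sum>w\<in>F. (cmod (coef (X m) w - coef (X n) w))\<^sup>2) \<le> (norm (X m - X n))\<^sup>2"
        using sum_coef_le_norm[OF \<open>finite F\<close>, of "X m - X n"] by simp
      also have "\<dots> \<le> e\<^sup>2"
        using \<open>\<And>m. m \<ge> n \<Longrightarrow> dist (X m) (X n) \<le> e\<close>[OF that] by (simp add: dist_norm power_mono)
      finally show ?thesis .
    qed
    then show "\<forall>\<^sub>F m in sequentially. (\<Sum>w\<in>F. (cmod (coef (X m) w - coef (X n) w))\<^sup>2) \<le> e\<^sup>2"
      by (auto intro: eventually_sequentiallyI[of n])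
  qed simp
  have square_summable: "(\<lambda>w. (cmod (L w - coef (X n) w))\<^sup>2) summable_on UNIV"
    if "\<And>m. m \<ge> n \<Longrightarrow> dist (X m) (X n) \<le> e" for n e
    using bound[OF _ that]
    by (intro nonneg_bdd_above_summable_on) (auto intro!: bdd_aboveI[of _ "e\<^sup>2"])
  obtain M where M: "\<And>m n. m \<ge> M \<Longrightarrow> n \<ge> M \<Longrightarrow> dist (X m) (X n) < 1"
    using metric_CauchyD[OF X, of 1] by auto
  have "(\<lambda>w. (cmod (L w - coef (X M) w + coef (X M) w))\<^sup>2) summable_on UNIV"
    using M by (intro square_summable_add square_summable[of M 1] coef_square_summable)
      (auto intro: less_imp_le)
  moreover have "L w = 0" if "\<not> v_word w" for w
    using L[of w] coef_outside[OF that] by (simp add: LIMSEQ_const_iff)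
  ultimately have coef_lim: "coef (Abs_fock L) = L"
    by (intro Abs_fock_inverse) auto
  have "X \<longlonglongrightarrow> Abs_fock L"
  proof (rule metric_LIMSEQ_I)
    fix e :: real assume "0 < e"
    then obtain M where M: "\<And>m n. m \<ge> M \<Longrightarrow> n \<ge> M \<Longrightarrow> dist (X m) (X n) < e / 2"
      using metric_CauchyD[OF X, of "e / 2"] by auto
    have "dist (X n) (Abs_fock L) < e" if "n \<ge> M" for n
    proof -
      have *: "dist (X m) (X n) \<le> e / 2" if "m \<ge> n" for m
        using M[of m n] that \<open>n \<ge> M\<close> by simp
      have "(norm (Abs_fock L - X n))\<^sup>2 \<le> (e / 2)\<^sup>2"
        unfolding norm_fock_power2 coef_simps coef_lim
        by (rule infsum_le_finite_sums[OF square_summable[OF *]]) (use bound[OF _ *] in auto)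
      then have "norm (Abs_fock L - X n) \<le> e / 2"
        by (rule power2_le_imp_le) (use \<open>0 < e\<close> in simp)
      then show ?thesis using \<open>0 < e\<close> by (simp add: dist_norm norm_minus_commute)
    qed
    then show "\<exists>no. \<forall>n\<ge>no. dist (X n) (Abs_fock L) < e" by blast
  qed
  then show "convergent X" by (auto simp: convergent_def)
qed

lift_definition fock_basis :: "nat list \<Rightarrow> fock" is
  "\<lambda>v w. if v_word v \<and> w = v then 1 else 0"
proof (intro conjI allI impI)
  fix v w :: "nat list"
  have "finite {w \<in> UNIV. (cmod (if v_word v \<and> w = v then 1 else 0))\<^sup>2 \<noteq> 0}"
    by (rule finite_subset[of _ "{v}"]) auto
  then show "(\<lambda>w. (cmod (if v_word v \<and> w = v then 1 else 0))\<^sup>2) summable_on UNIV"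
    by (rule finite_nonzero_values_imp_summable_on)
  assume "\<not> v_word w"
  then show "(if v_word v \<and> w = v then 1 else 0) = (0 :: complex)" by auto
qed

abbreviation vacuum :: fock (\<open>\<Omega>\<close>) where
  "\<Omega> \<equiv> fock_basis []"

lemma fock_basis_outside [simp]: "\<not> v_word v \<Longrightarrow> fock_basis v = 0"
  by transfer auto

lemma cinner_fock_basis: "cinner f (fock_basis v) = coef f v"
proof -
  have "cinner f (fock_basis v) = (\<Sum>\<^sub>\<infinity>w\<in>{v}. coef f w * cnj (coef (fock_basis v) w))"
    unfolding cinner_def by (rule infsum_cong_neutral) (auto simp: fock_basis.rep_eq)
  then show ?thesis by (auto simp: fock_basis.rep_eq coef_outside)
qed

lemma fock_basis_orthonormal:
  "v_word v \<Longrightarrow> v_word w \<Longrightarrow> cinner (fock_basis v) (fock_basis w) = (if v = w then 1 else 0)"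
  by (simp add: cinner_fock_basis fock_basis.rep_eq)

lemma fock_basis_expansion: "((\<lambda>w. scaleC (coef f w) (fock_basis w)) has_sum f) UNIV"
  unfolding has_sum_def tendsto_iff eventually_finite_subsets_at_top
proof (intro allI impI)
  fix e :: real assume e: "0 < e"
  have "((\<lambda>w. (cmod (coef f w))\<^sup>2) has_sum (norm f)\<^sup>2) UNIV"
    using has_sum_infsum[OF coef_square_summable[of f]] by (simp add: norm_fock_power2)
  then obtain F where F: "finite F"
    "\<And>G. finite G \<Longrightarrow> F \<subseteq> G \<Longrightarrow> dist (\<Sum>w\<in>G. (cmod (coef f w))\<^sup>2) ((norm f)\<^sup>2) < e\<^sup>2"
    unfolding has_sum_def tendsto_iff eventually_finite_subsets_at_top
    using e by (meson subset_UNIV zero_less_power)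
  have "dist (\<Sum>w\<in>G. scaleC (coef f w) (fock_basis w)) f < e" if "finite G" "F \<subseteq> G" for G
  proof -
    have coef: "coef (f - (\<Sum>w\<in>G. scaleC (coef f w) (fock_basis w))) u =
        (if u \<in> G then 0 else coef f u)" for u
    proof -
      have "(\<Sum>w\<in>G. coef f w * coef (fock_basis w) u) = (\<Sum>w\<in>G. if w = u then coef f u else 0)"
        by (rule sum.cong) (auto simp: fock_basis.rep_eq coef_outside)
      then show ?thesis using that(1) by (simp add: coef_sum)
    qed
    have "(norm f)\<^sup>2 = (\<Sum>\<^sub>\<infinity>w\<in>G \<union> - G. (cmod (coef f w))\<^sup>2)" by (simp add: norm_fock_power2)
    also have "\<dots> = (\<Sum>\<^sub>\<infinity>w\<in>G. (cmod (coef f w))\<^sup>2) + (\<Sum>\<^sub>\<infinity>w\<in>- G. (cmod (coef f w))\<^sup>2)"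
      by (rule infsum_Un_disjoint)
        (auto intro: summable_on_subset_banach[OF coef_square_summable])
    also have "(\<Sum>\<^sub>\<infinity>w\<in>- G. (cmod (coef f w))\<^sup>2) =
        (norm (f - (\<Sum>w\<in>G. scaleC (coef f w) (fock_basis w))))\<^sup>2"
      unfolding norm_fock_power2 coef by (rule infsum_cong_neutral) auto
    finally have "(norm (f - (\<Sum>w\<in>G. scaleC (coef f w) (fock_basis w))))\<^sup>2 < e\<^sup>2"
      using F(2)[OF that] that(1) by (simp add: dist_norm abs_less_iff)
    then show ?thesis
      using e power_less_imp_less_base[of _ 2 e] by (simp add: dist_norm norm_minus_commute)
  qed
  then show "\<exists>F. finite F \<and> F \<subseteq> UNIV \<and> (\<forall>G. finite G \<and> F \<subseteq> G \<and> G \<subseteq> UNIV \<longrightarrow>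
      dist (sum (\<lambda>w. scaleC (coef f w) (fock_basis w)) G) f < e)"
    using F(1) by blast
qed

section \<open>Creation, annihilation and conservation operators\<close>

lemma square_summable_Cons:
  fixes f :: "nat list \<Rightarrow> complex"
  assumes "(\<lambda>w. (cmod (f w))\<^sup>2) summable_on UNIV"
  shows "(\<lambda>w. (cmod (f (i # w)))\<^sup>2) summable_on UNIV"
  using summable_on_reindex[of "(#) i" UNIV "\<lambda>w. (cmod (f w))\<^sup>2"]
    summable_on_subset_banach[OF assms, of "range ((#) i)"]
  by (simp add: o_def)

text \<open>The operators are given by their action on coefficients; the lemmas below show that
  this is the required action on basis vectors.\<close>

lift_definition creation :: "nat \<Rightarrow> fock \<Rightarrow> fock" is
  "\<lambda>i f w. if v_word w \<and> w \<noteq> [] \<and> hd w = i then f (tl w) else 0"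
proof -
  fix i and f :: "nat list \<Rightarrow> complex"
  assume f: "(\<lambda>w. (cmod (f w))\<^sup>2) summable_on UNIV \<and> (\<forall>w. \<not> v_word w \<longrightarrow> f w = 0)"
  have "(\<lambda>w. (cmod (f (tl w)))\<^sup>2) summable_on range ((#) i)"
    using f by (subst summable_on_reindex) (auto simp: o_def)
  then have "(\<lambda>w. (cmod (if w \<noteq> [] \<and> hd w = i then f (tl w) else 0))\<^sup>2) summable_on UNIV"
    by (rule summable_on_cong_neutral[THEN iffD1, rotated -1]) (auto simp: image_iff neq_Nil_conv)
  then have "(\<lambda>w. (cmod (if v_word w \<and> w \<noteq> [] \<and> hd w = i then f (tl w) else 0))\<^sup>2)
      summable_on UNIV"
    by (rule summable_on_comparison_test) auto
  then show "(\<lambda>w. (cmod (if v_word w \<and> w \<noteq> [] \<and> hd w = i then f (tl w) else 0))\<^sup>2)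
      summable_on UNIV \<and>
    (\<forall>w. \<not> v_word w \<longrightarrow> (if v_word w \<and> w \<noteq> [] \<and> hd w = i then f (tl w) else 0) = 0)"
    by simp
qed

lift_definition annihilation :: "nat \<Rightarrow> fock \<Rightarrow> fock" is "\<lambda>i f w. f (i # w)"
  by (auto intro: square_summable_Cons dest: v_word_ConsD)

lift_definition conservation :: "nat \<Rightarrow> fock \<Rightarrow> fock" is
  "\<lambda>i f w. if w \<noteq> [] \<and> hd w = i then f w else 0"
  by (auto elim!: summable_on_comparison_test)

lemma creation_basis: "v_word w \<Longrightarrow> creation i (fock_basis w) = fock_basis (i # w)"
  by (rule fock_eqI) (auto simp: creation.rep_eq fock_basis.rep_eq neq_Nil_conv)

lemma annihilation_vacuum: "annihilation i \<Omega> = 0"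
  by (rule fock_eqI) (simp add: annihilation.rep_eq fock_basis.rep_eq)

lemma annihilation_basis:
  "v_word (j # w) \<Longrightarrow> annihilation i (fock_basis (j # w)) = (if i = j then fock_basis w else 0)"
  by (rule fock_eqI) (auto simp: annihilation.rep_eq fock_basis.rep_eq dest: v_word_ConsD)

lemma conservation_vacuum: "conservation i \<Omega> = 0"
  by (rule fock_eqI) (simp add: conservation.rep_eq fock_basis.rep_eq)

lemma conservation_basis:
  "v_word (j # w) \<Longrightarrow>
    conservation i (fock_basis (j # w)) = (if i = j then fock_basis (j # w) else 0)"
  by (rule fock_eqI) (auto simp: conservation.rep_eq fock_basis.rep_eq)

lemma operators_scaleC:
  "creation i (scaleC c f) = scaleC c (creation i f)"
  "annihilation i (scaleC c f) = scaleC c (annihilation i f)"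
  "conservation i (scaleC c f) = scaleC c (conservation i f)"
  by (auto intro!: fock_eqI simp: creation.rep_eq annihilation.rep_eq conservation.rep_eq)

lemma norm_fock_mono_image:
  assumes "inj_on h S" "\<And>w. w \<in> S \<Longrightarrow> cmod (coef f w) \<le> cmod (coef g (h w))"
    "\<And>w. w \<notin> S \<Longrightarrow> coef f w = 0"
  shows "norm f \<le> norm g"
proof -
  have "(norm f)\<^sup>2 \<le> (norm g)\<^sup>2"
    unfolding norm_fock_power2[of f]
  proof (rule infsum_le_finite_sums[OF coef_square_summable])
    fix F :: "nat list set" assume F: "finite F"
    have "(\<Sum>w\<in>F. (cmod (coef f w))\<^sup>2) = (\<Sum>w\<in>F \<inter> S. (cmod (coef f w))\<^sup>2)"
      using F assms(3) by (intro sum.mono_neutral_right) auto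
    also have "\<dots> \<le> (\<Sum>w\<in>F \<inter> S. (cmod (coef g (h w)))\<^sup>2)"
      using assms(2) by (intro sum_mono power_mono) auto
    also have "\<dots> = (\<Sum>w\<in>h ` (F \<inter> S). (cmod (coef g w))\<^sup>2)"
      using assms(1) by (subst sum.reindex) (auto intro: inj_on_subset)
    also have "\<dots> \<le> (norm g)\<^sup>2" using F by (intro sum_coef_le_norm) auto
    finally show "(\<Sum>w\<in>F. (cmod (coef f w))\<^sup>2) \<le> (norm g)\<^sup>2" .
  qed
  then show ?thesis by (rule power2_le_imp_le) simp
qed

lemma bounded_linear_creation: "bounded_linear (creation i)"
proof (rule bounded_linear_intro[of _ 1])
  show "norm (creation i f) \<le> norm f * 1" for f
    unfolding mult_1_right
    by (rule norm_fock_mono_image[of tl "range ((#) i)"])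
      (auto simp: inj_on_def creation.rep_eq image_iff neq_Nil_conv)
qed (auto intro!: fock_eqI simp: creation.rep_eq)

lemma bounded_linear_annihilation: "bounded_linear (annihilation i)"
proof (rule bounded_linear_intro[of _ 1])
  show "norm (annihilation i f) \<le> norm f * 1" for f
    using norm_fock_mono_image[of "(#) i" UNIV "annihilation i f" f]
    by (auto simp: annihilation.rep_eq)
qed (auto intro!: fock_eqI simp: annihilation.rep_eq)

lemma bounded_linear_conservation: "bounded_linear (conservation i)"
proof (rule bounded_linear_intro[of _ 1])
  show "norm (conservation i f) \<le> norm f * 1" for f
    using norm_fock_mono_image[of id UNIV "conservation i f" f]
    by (auto simp: conservation.rep_eq)
qed (auto intro!: fock_eqI simp: conservation.rep_eq)

definition vacuum_state :: "(fock \<Rightarrow> fock) \<Rightarrow> complex" where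
  "vacuum_state b = cinner (b \<Omega>) \<Omega>"

definition S_op :: "nat \<Rightarrow> real \<Rightarrow> fock \<Rightarrow> fock" where
  "S_op N lam f =
     (\<Sum>i = 1..N. (creation i f + annihilation i f) /\<^sub>R sqrt (real N) + lam *\<^sub>R conservation i f)"

section \<open>Ordered noncrossing partitions with V-monotone labelings\<close>

definition noncrossing :: "nat set set \<Rightarrow> bool" where
  "noncrossing P \<longleftrightarrow>
     (\<forall>B\<in>P. \<forall>B'\<in>P. B \<noteq> B' \<longrightarrow>
        \<not> (\<exists>a\<in>B. \<exists>b\<in>B'. \<exists>c\<in>B. \<exists>d\<in>B'. a < b \<and> b < c \<and> c < d))"

definition NC2plus :: "nat \<Rightarrow> nat set set set" where
  "NC2plus n = {P. partition_on {1..n} P \<and> noncrossing P \<and> (\<forall>B\<in>P. 2 \<le> card B)}"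

text \<open>\<open>block_less B' B\<close>, i.e. \<open>B' \<prec> B\<close>: the inner block \<open>B\<close> lies strictly between two
  consecutive elements \<open>a < b\<close> of the outer block \<open>B'\<close>.\<close>

definition block_less :: "nat set \<Rightarrow> nat set \<Rightarrow> bool" where
  "block_less B' B \<longleftrightarrow>
     (\<exists>a\<in>B'. \<exists>b\<in>B'. a < b \<and> B' \<inter> {a<..<b} = {} \<and> a < Min B \<and> Max B < b)"

text \<open>A maximal chain \<open>B\<^sub>1 \<prec> \<dots> \<prec> B\<^sub>r\<close> is listed as \<open>[B\<^sub>1, \<dots>, B\<^sub>r]\<close>, outermost block first.\<close>

definition v_monotone :: "nat set set \<Rightarrow> (nat set \<Rightarrow> nat) \<Rightarrow> bool" where
  "v_monotone P L \<longleftrightarrow>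
     (\<forall>C. sorted_wrt block_less C \<and> pred_on.maxchain P block_less (set C)
        \<longrightarrow> v_word (rev (map L C)))"

definition block_label :: "nat set list \<Rightarrow> nat set \<Rightarrow> nat" where
  "block_label Bs = the_inv_into {1..length Bs} (\<lambda>j. Bs ! (j - 1))"

lemma block_label_nth:
  assumes "distinct Bs" "j \<in> {1..length Bs}"
  shows "block_label Bs (Bs ! (j - 1)) = j"
  unfolding block_label_def
  using assms by (intro the_inv_into_f_f) (auto simp: inj_on_def nth_eq_iff_index_eq)

definition OV2plus :: "nat \<Rightarrow> nat \<Rightarrow> nat set list set" where
  "OV2plus n k = {Bs. length Bs = k \<and> distinct Bs \<and> set Bs \<in> NC2plus n \<and>
     v_monotone (set Bs) (block_label Bs)}"

lemma finite_OV2plus: "finite (OV2plus n k)"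
proof (rule finite_subset)
  show "OV2plus n k \<subseteq> {Bs. set Bs \<subseteq> Pow {1..n} \<and> length Bs = k}"
    by (auto simp: OV2plus_def NC2plus_def partition_on_def)
  show "finite {Bs. set Bs \<subseteq> Pow {1..n} \<and> length Bs = k}"
    by (intro finite_lists_length_eq) auto
qed

end

theory Submission
  imports Defs
begin

text \<open>
Expand \<open>S_op N lam ^^ n\<close> on the vacuum and read the \<open>n\<close> factors from right to left as the
points \<open>1, \<dots>, n\<close>. A creation operator starts a block of a partition and pushes its label on a
stack, a conservation operator adds a point to the block on top of the stack, and an annihilation
operator adds a last point to that block and pops its label. So after \<open>t\<close> factors the vector is a
weighted sum over the noncrossing configurations on \<open>{1..t}\<close> (\<open>configs\<close>), with some blocks
closed and some open, and over the labelings for which the stack has been a V-word at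
every creation. Since configurations at time \<open>t + 1\<close> arise from those at time \<open>t\<close> by exactly these
three steps (\<open>configs_Suc\<close>), the expansion is an induction on \<open>t\<close> (\<open>S_op_power_vacuum\<close>). A closed
block has at least two points, one from its creation and one from its annihilation.

The vacuum coefficient keeps the configurations without open blocks. The stack at the creation of
\<open>B\<close> consists of the blocks that surround \<open>B\<close>, and the V-word condition for all these stacks is
V-monotonicity: stacks are initial, outer parts of maximal chains, and every nonempty maximal chain is the
stack of its innermost block (\<open>v_monotone_iff\<close>). With \<open>N\<close> available labels the moment is hence the
sum, over the partitions \<open>P\<close> in \<open>NC2plus n\<close>, of the number of V-monotone labelings of \<open>P\<close> by
\<open>{1..N}\<close> times \<open>lam ^ (n - 2 * card P) / N ^ card P\<close> (\<open>vacuum_moment\<close>).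

For \<open>k\<close> blocks almost all of the \<open>N ^ k\<close> labelings are injective as \<open>N\<close> grows, and V-monotonicity
of an injective labeling depends only on the order it induces on the blocks. A set of \<open>k\<close> labels can
be distributed in as many V-monotone ways as \<open>{1..k}\<close>, so the number of V-monotone
labelings divided by \<open>N ^ k\<close> tends to the number of V-monotone orderings of the blocks divided by
\<open>k!\<close> (\<open>labellings_limit\<close>). Summing the orderings over all partitions with \<open>k\<close> blocks gives
\<open>OV2plus n k\<close> (\<open>card_OV2plus\<close>).
\<close>

section \<open>Noncrossing partitions under construction\<close>

lemma partition_on_eq_block:
  "partition_on A P \<Longrightarrow> B \<in> P \<Longrightarrow> D \<in> P \<Longrightarrow> x \<in> B \<Longrightarrow> x \<in> D \<Longrightarrow> B = D"
  using disjointD[OF partition_onD2] by fastforce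

lemma partition_on_insert_iff:
  assumes "B \<notin> R"
  shows "partition_on A (insert B R) \<longleftrightarrow>
    A = B \<union> \<Union>R \<and> B \<noteq> {} \<and> B \<inter> \<Union>R = {} \<and> disjoint R \<and> {} \<notin> R"
proof -
  have "disjoint (insert B R) \<longleftrightarrow> B \<inter> \<Union>R = {} \<and> disjoint R"
    using assms by (auto simp: pairwise_insert disjnt_def)
  then show ?thesis unfolding partition_on_def by auto
qed

text \<open>Together with its analogue for a new singleton block, this transports the partition property
between consecutive times of the scan, in both directions.\<close>

lemma partition_on_grow:
  assumes "x \<notin> A" "x \<notin> B" "B \<noteq> {}" "B \<notin> R" "insert x B \<notin> R"
  shows "partition_on (insert x A) (insert (insert x B) R) \<longleftrightarrow> partition_on A (insert B R)"
proof -
  have *: "insert x A = insert x B \<union> \<Union>R \<longleftrightarrow> A = B \<union> \<Union>R" if "x \<notin> \<Union>R"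
    using that assms(1,2) insert_ident[of x A "B \<union> \<Union>R"] by auto
  have "x \<notin> \<Union>R" if "A = B \<union> \<Union>R" using that assms(1) by auto
  then have **: "insert x A = insert x B \<union> \<Union>R \<and> insert x B \<inter> \<Union>R = {} \<longleftrightarrow>
      A = B \<union> \<Union>R \<and> B \<inter> \<Union>R = {}"
    using * by (metis Int_insert_left Un_iff insert_not_empty)
  show ?thesis
    unfolding partition_on_insert_iff[OF assms(4)] partition_on_insert_iff[OF assms(5)]
    using ** assms(3) by simp argo
qed

lemma partition_on_insert_singleton:
  assumes "x \<notin> A" "{x} \<notin> R"
  shows "partition_on (insert x A) (insert {x} R) \<longleftrightarrow> partition_on A R"
proof
  assume *: "partition_on (insert x A) (insert {x} R)"
  then have "x \<notin> \<Union>R" using partition_on_eq_block[OF *, of "{x}"] assms(2) by auto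
  moreover have "insert x A = insert x (\<Union>R)" using * unfolding partition_on_def by auto
  ultimately have "A = \<Union>R" using assms(1) by (metis insert_ident)
  then show "partition_on A R"
    using * unfolding partition_on_def by (auto simp: pairwise_insert)
next
  assume "partition_on A R"
  then show "partition_on (insert x A) (insert {x} R)"
    using assms(1) unfolding partition_on_def by (auto simp: pairwise_insert disjnt_def)
qed

text \<open>A configuration \<open>(C, Os)\<close> is the state of a left-to-right scan of a noncrossing partition after
the points \<open>1, \<dots>, t\<close>: \<open>C\<close> holds the closed blocks, which receive no further points, and \<open>Os\<close> is
the stack of open blocks, innermost block first. Only the top of the stack may
receive the next point, so a deeper open block lies entirely to the left of a shallower one, and a
closed block cannot straddle a point of an open block: the open block will still acquire
later points, and these would cross the closed block.\<close>

type_synonym config = "nat set set \<times> nat set list"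

definition configs :: "nat \<Rightarrow> config set" where
  "configs t = {(C, Os). partition_on {1..t} (C \<union> set Os) \<and> C \<inter> set Os = {} \<and>
     noncrossing C \<and> (\<forall>D\<in>C. 2 \<le> card D) \<and>
     sorted_wrt (\<lambda>B B'. \<forall>b\<in>B. \<forall>b'\<in>B'. b' < b) Os \<and>
     (\<forall>D\<in>C. \<forall>B\<in>set Os. \<forall>a\<in>D. \<forall>b\<in>B. \<forall>c\<in>D. \<not> (a < b \<and> b < c))}"

fun push_block :: "nat \<Rightarrow> config \<Rightarrow> config" where
  "push_block x (C, Os) = (C, {x} # Os)"

fun extend_block :: "nat \<Rightarrow> config \<Rightarrow> config" where
  "extend_block x (C, Os) = (C, insert x (hd Os) # tl Os)"

fun close_block :: "nat \<Rightarrow> config \<Rightarrow> config" where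
  "close_block x (C, Os) = (insert (insert x (hd Os)) C, tl Os)"

abbreviation open_configs :: "nat \<Rightarrow> config set" where
  "open_configs t \<equiv> {c \<in> configs t. snd c \<noteq> []}"

lemma configs_block_subset:
  assumes "(C, Os) \<in> configs t" "B \<in> C \<union> set Os"
  shows "B \<subseteq> {1..t}" "B \<noteq> {}" "finite B" "Suc t \<notin> B"
proof -
  show *: "B \<subseteq> {1..t}" "B \<noteq> {}" using assms unfolding configs_def partition_on_def by blast+
  show "finite B" using *(1) by (rule finite_subset) simp
  show "Suc t \<notin> B" using *(1) by auto
qed

lemma configs_top_fresh:
  assumes "(C, B # Os) \<in> configs t"
  shows "B \<notin> C \<union> set Os"
proof -
  obtain b where b: "b \<in> B" using configs_block_subset(2)[OF assms, of B] by auto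
  have "B \<notin> set Os"
  proof
    assume "B \<in> set Os"
    moreover have "\<forall>B'\<in>set Os. \<forall>b\<in>B. \<forall>b'\<in>B'. b' < b"
      using assms unfolding configs_def by auto
    ultimately have "b < b" using b by blast
    then show False by simp
  qed
  then show ?thesis using assms unfolding configs_def by auto
qed

lemma noncrossing_subset: "noncrossing C \<Longrightarrow> C' \<subseteq> C \<Longrightarrow> noncrossing C'"
  unfolding noncrossing_def by blast

text \<open>When the top block is closed by a new largest point \<open>x\<close>, a crossing with an old closed block
would give two points of the old block with a point of \<open>B\<close> between them, because \<open>x\<close>
itself can only be the last of the four crossing points.\<close>

lemma noncrossing_insert_top:
  assumes "noncrossing C" "\<forall>D\<in>C. \<forall>a\<in>D. \<forall>b\<in>B. \<forall>c\<in>D. \<not> (a < b \<and> b < c)"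
    "\<forall>D\<in>C. \<forall>a\<in>D. a < x"
  shows "noncrossing (insert (insert x B) C)"
proof -
  have "\<not> (a < b \<and> b < c \<and> c < d)"
    if "D \<in> C" "a \<in> D" "b \<in> insert x B" "c \<in> D" "d \<in> insert x B" for D a b c d
    using that assms(2,3) by (metis insertE order.asym)
  moreover have "\<not> (a < b \<and> b < c \<and> c < d)"
    if "D \<in> C" "a \<in> insert x B" "b \<in> D" "c \<in> insert x B" "d \<in> D" for D a b c d
    using that assms(2,3) by (metis insertE order.asym)
  moreover have "\<not> (a < b \<and> b < c \<and> c < d)"
    if "D \<in> C" "D' \<in> C" "D \<noteq> D'" "a \<in> D" "b \<in> D'" "c \<in> D" "d \<in> D'" for D D' a b c d
    using that assms(1) unfolding noncrossing_def by blast
  ultimately show ?thesis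
    unfolding noncrossing_def by (metis insertE)
qed

text \<open>The new point either starts a block, or joins the top block, which then stays open or gets
closed. Conversely, the block \<open>D\<close> of the last point determines which of the three happened: if it
is open, it is the top of the stack, since its last point lies to the right of everything; if it
is closed, then deleting the last point leaves an admissible new top, since a
point of an open block to the right of a point of \<open>D\<close> would be straddled by \<open>D\<close>.\<close>

lemma configs_Suc:
  "configs (Suc t) = push_block (Suc t) ` configs t \<union> extend_block (Suc t) ` open_configs t \<union>
     close_block (Suc t) ` open_configs t" (is "_ = ?P \<union> ?E \<union> ?K")
proof -
  let ?x = "Suc t"
  have x: "{1..Suc t} = insert ?x {1..t}" "?x \<notin> {1..t}" by auto
  show ?thesis
  proof (intro equalityI subsetI)
    fix c assume "c \<in> configs (Suc t)"
    then obtain C Os where c: "c = (C, Os)" "(C, Os) \<in> configs (Suc t)" by (cases c) auto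
    note sub = configs_block_subset[OF c(2)]
    from c(2) have part: "partition_on {1..Suc t} (C \<union> set Os)" and disj: "C \<inter> set Os = {}"
      and nc: "noncrossing C" and card: "\<forall>D\<in>C. 2 \<le> card D"
      and srt: "sorted_wrt (\<lambda>B B'. \<forall>b\<in>B. \<forall>b'\<in>B'. b' < b) Os"
      and cov: "\<forall>D\<in>C. \<forall>B\<in>set Os. \<forall>a\<in>D. \<forall>b\<in>B. \<forall>c\<in>D. \<not> (a < b \<and> b < c)"
      unfolding configs_def by auto
    obtain D where D: "?x \<in> D" "D \<in> C \<union> set Os"
      using part unfolding partition_on_def x by blast
    have uniq: "E = D" if "E \<in> C \<union> set Os" "E \<inter> D \<noteq> {}" for E
      using partition_on_eq_block[OF part that(1) D(2)] that(2) by auto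
    have notin: "D - {?x} \<notin> C \<union> set Os" if "D - {?x} \<noteq> {}"
      using uniq[of "D - {?x}"] that D(1) by blast
    have D_eq: "insert ?x (D - {?x}) = D" using D(1) by auto
    show "c \<in> ?P \<union> ?E \<union> ?K"
    proof (cases "D \<in> C")
      case True
      let ?B = "D - {?x}"
      \<comment> \<open>Closed blocks have at least two points.\<close>
      have ne: "?B \<noteq> {}"
      proof
        assume "?B = {}"
        then have "D = {?x}" using D(1) by auto
        then show False using card True by fastforce
      qed
      have B: "?B \<notin> C \<union> set Os" using notin ne .
      have eq: "C \<union> set Os = insert D ((C - {D}) \<union> set Os)" using True by auto
      have "partition_on {1..t} (insert ?B ((C - {D}) \<union> set Os))"
        using partition_on_grow[of ?x "{1..t}" ?B "(C - {D}) \<union> set Os"] part B disj True ne x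
        unfolding eq D_eq by auto
      moreover have "noncrossing (C - {D})" using nc by (rule noncrossing_subset) auto
      moreover have "\<forall>b\<in>?B. \<forall>b'\<in>B'. b' < b" if "B' \<in> set Os" for B'
      proof (intro ballI)
        fix b b' assume b: "b \<in> ?B" "b' \<in> B'"
        have "b' < ?x" using sub(1)[of B'] that b(2) uniq[of B'] True disj D(1)
          by (metis Un_iff atLeastAtMost_iff disjoint_iff le_neq_implies_less subsetD)
        moreover have "b' \<noteq> b" using uniq[of B'] b that True disj by blast
        moreover have "\<not> (b < b' \<and> b' < ?x)" using cov True that b D(1) by blast
        ultimately show "b' < b" by simp
      qed
      moreover have "\<forall>E\<in>C - {D}. \<forall>a\<in>E. \<forall>b\<in>?B. \<forall>c\<in>E. \<not> (a < b \<and> b < c)"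
      proof (intro ballI notI)
        fix E a b c assume *: "E \<in> C - {D}" "a \<in> E" "b \<in> ?B" "c \<in> E" "a < b \<and> b < c"
        have "c < ?x" using sub(1)[of E] * uniq[of E] D(1)
          by (metis Diff_iff IntI Un_iff atLeastAtMost_iff empty_iff insertI1
              le_neq_implies_less subsetD)
        then show False using nc * True D(1) unfolding noncrossing_def by blast
      qed
      ultimately have "(C - {D}, ?B # Os) \<in> configs t"
        using B disj card srt cov unfolding configs_def by auto
      moreover have "c = close_block ?x (C - {D}, ?B # Os)" using c True D_eq by auto
      ultimately show ?thesis by (intro UnI2 image_eqI) auto
    next
      case False
      then have DO: "D \<in> set Os" using D by auto
      then obtain B Os' where Os: "Os = B # Os'" by (cases Os) auto
      have "B = D"
      proof (rule ccontr)
        assume "B \<noteq> D"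
        then have *: "\<forall>b\<in>B. ?x < b" using DO srt D(1) unfolding Os by auto
        show False using * sub(1)[of B] sub(2)[of B] unfolding Os by fastforce
      qed
      note Os = Os[unfolded this]
      have DOs': "D \<notin> set Os'"
        using srt D(1) unfolding Os by auto
      show ?thesis
      proof (cases "D = {?x}")
        case True
        have "partition_on {1..t} (C \<union> set Os')"
          using partition_on_insert_singleton[of ?x "{1..t}" "C \<union> set Os'"] part False DOs'
          unfolding Os x True by auto
        then have "(C, Os') \<in> configs t"
          using disj nc card srt cov unfolding configs_def Os by auto
        moreover have "c = push_block ?x (C, Os')" using c Os True by simp
        ultimately show ?thesis by blast
      next
        case ne: False
        let ?B = "D - {?x}"
        have ne: "?B \<noteq> {}" using ne D(1) by auto
        have B: "?B \<notin> C \<union> set Os" using notin ne .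
        have eq: "C \<union> set Os = insert D (C \<union> set Os')" using Os by auto
        have "partition_on {1..t} (insert ?B (C \<union> set Os'))"
          using partition_on_grow[of ?x "{1..t}" ?B "C \<union> set Os'"] part B False DOs' ne x Os
          unfolding eq D_eq by auto
        then have "(C, ?B # Os') \<in> configs t"
          using B disj nc card srt cov unfolding configs_def Os by auto
        moreover have "c = extend_block ?x (C, ?B # Os')" using c Os D_eq by simp
        ultimately show ?thesis by (intro UnI1 UnI2 image_eqI) auto
      qed
    qed
  next
    fix c assume "c \<in> ?P \<union> ?E \<union> ?K"
    then consider C Os where "c = push_block ?x (C, Os)" "(C, Os) \<in> configs t"
      | C B Os where "c = extend_block ?x (C, B # Os)" "(C, B # Os) \<in> configs t"
      | C B Os where "c = close_block ?x (C, B # Os)" "(C, B # Os) \<in> configs t"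
      by (auto simp: neq_Nil_conv)
    then show "c \<in> configs (Suc t)"
    proof cases
      case 1
      note sub = configs_block_subset[OF 1(2)]
      have lt: "b < ?x" if "b \<in> B" "B \<in> C \<union> set Os" for b B
        using sub(1)[OF that(2)] that(1) by auto
      have "{?x} \<notin> C \<union> set Os" using sub(4) by blast
      moreover have "partition_on {1..Suc t} (insert {?x} (C \<union> set Os))"
        using partition_on_insert_singleton[OF x(2) \<open>{?x} \<notin> C \<union> set Os\<close>] 1(2)
        unfolding configs_def x(1) by auto
      moreover have "\<not> ?x < c" if "c \<in> D" "D \<in> C" for c D
        using lt[of c D] that by auto
      ultimately show ?thesis using 1 lt unfolding configs_def by auto
    next
      case 2
      note sub = configs_block_subset[OF 2(2)]
      have lt: "b < ?x" if "b \<in> B'" "B' \<in> C \<union> set (B # Os)" for b B'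
        using sub(1)[OF that(2)] that(1) by auto
      have ne: "B \<noteq> {}" using sub(2)[of B] by simp
      have nin: "B \<notin> C \<union> set Os" using configs_top_fresh[OF 2(2)] .
      have nin': "insert ?x B \<notin> C \<union> set Os" using sub(4)[of "insert ?x B"] by auto
      have "partition_on {1..Suc t} (insert (insert ?x B) (C \<union> set Os))"
        using partition_on_grow[of ?x "{1..t}" B "C \<union> set Os"] 2(2) nin nin' ne x sub(4)[of B]
        unfolding configs_def by auto
      moreover have "\<not> ?x < c" if "c \<in> D" "D \<in> C" for c D
        using lt[of c D] that by auto
      ultimately show ?thesis using 2 lt nin' unfolding configs_def by auto
    next
      case 3
      note sub = configs_block_subset[OF 3(2)]
      have lt: "b < ?x" if "b \<in> B'" "B' \<in> C \<union> set (B # Os)" for b B'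
        using sub(1)[OF that(2)] that(1) by auto
      have ne: "B \<noteq> {}" using sub(2)[of B] by simp
      have nin: "B \<notin> C \<union> set Os" using configs_top_fresh[OF 3(2)] .
      have nin': "insert ?x B \<notin> C \<union> set Os" using sub(4)[of "insert ?x B"] by auto
      have "partition_on {1..Suc t} (insert (insert ?x B) (C \<union> set Os))"
        using partition_on_grow[of ?x "{1..t}" B "C \<union> set Os"] 3(2) nin nin' ne x sub(4)[of B]
        unfolding configs_def by auto
      moreover have "noncrossing (insert (insert ?x B) C)"
        by (rule noncrossing_insert_top) (use 3(2) lt in \<open>auto simp: configs_def\<close>)
      moreover have "2 \<le> card (insert ?x B)"
        using sub(3,4)[of B] ne by (simp add: Suc_le_eq card_gt_0_iff)
      moreover have "\<not> (a < b \<and> b < c)"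
        if "a \<in> insert ?x B" "b \<in> B'" "B' \<in> set Os" for a b c B'
      proof -
        have "b < a" using that lt[of b B'] 3(2) unfolding configs_def by auto
        then show ?thesis by simp
      qed
      ultimately show ?thesis using 3 nin' unfolding configs_def by auto
    qed
  qed
qed

section \<open>V-monotone labels of the blocks\<close>

fun blocks :: "config \<Rightarrow> nat set set" where
  "blocks (C, Os) = C \<union> set Os"

abbreviation openers :: "config \<Rightarrow> nat set" where
  "openers c \<equiv> Min ` blocks c"

text \<open>The first points of the blocks that are open just after the point \<open>x\<close> has been read, for
\<open>x\<close> a first point: a closed block was open at that time iff \<open>x\<close> does not exceed its maximum.
Blocks are represented by their first points because a block keeps its first point while it grows.\<close>

fun birth_stack :: "config \<Rightarrow> nat \<Rightarrow> nat set" where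
  "birth_stack (C, Os) x = Min ` ({D \<in> C. Min D \<le> x \<and> x \<le> Max D} \<union> {B \<in> set Os. Min B \<le> x})"

text \<open>Labels live on the first points of the blocks. The condition says that at each creation of a block
the labels on the stack, read from the top, formed a V-word; otherwise the creation
operator has produced \<open>0\<close>.\<close>

definition v_labels :: "nat \<Rightarrow> config \<Rightarrow> (nat \<Rightarrow> nat) set" where
  "v_labels N c = {l \<in> openers c \<rightarrow>\<^sub>E {1..N}.
     \<forall>x\<in>openers c. v_word (map l (rev (sorted_list_of_set (birth_stack c x))))}"

definition stack_word :: "config \<Rightarrow> (nat \<Rightarrow> nat) \<Rightarrow> nat list" where
  "stack_word c l = map (l \<circ> Min) (snd c)"

lemma configs_blocks:
  assumes "c \<in> configs t" "B \<in> blocks c"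
  shows "finite B" "B \<noteq> {}" "Min B \<in> B" "Max B \<in> B" "Min B \<le> t" "Max B \<le> t"
proof -
  obtain C Os where c: "c = (C, Os)" by (cases c)
  note sub = configs_block_subset[OF assms(1)[unfolded c] assms(2)[unfolded c blocks.simps]]
  show 1: "finite B" "B \<noteq> {}" using sub by auto
  then show 2: "Min B \<in> B" "Max B \<in> B" by auto
  show "Min B \<le> t" "Max B \<le> t" using 2 sub(1) by auto
qed

lemma openers_le: "c \<in> configs t \<Longrightarrow> x \<in> openers c \<Longrightarrow> x \<le> t"
  using configs_blocks(5) by blast

lemma finite_blocks: "c \<in> configs t \<Longrightarrow> finite (blocks c)"
  using finite_elements[of "{1..t}"] by (cases c) (auto simp: configs_def)

lemma finite_configs: "finite (configs t)"
proof (induction t)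
  case 0
  have "configs 0 \<subseteq> {({}, [])}"
    by (auto simp: configs_def partition_on_empty)
  then show ?case by (rule finite_subset) simp
next
  case (Suc t)
  then show ?case unfolding configs_Suc by simp
qed

lemma birth_stack_subset: "birth_stack c x \<subseteq> openers c"
  by (cases c) auto

lemma finite_birth_stack: "c \<in> configs t \<Longrightarrow> finite (birth_stack c x)"
  using finite_blocks birth_stack_subset by (metis finite_imageI finite_subset)

lemma stack_sorted:
  assumes "(C, Os) \<in> configs t"
  shows "sorted_wrt (>) (map Min Os)"
  unfolding sorted_wrt_map
proof (rule sorted_wrt_mono_rel)
  show "sorted_wrt (\<lambda>B B'. \<forall>b\<in>B. \<forall>b'\<in>B'. b' < b) Os" using assms by (auto simp: configs_def)
  fix B B' assume "B \<in> set Os" "B' \<in> set Os" "\<forall>b\<in>B. \<forall>b'\<in>B'. b' < b"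
  then show "Min B > Min B'"
    using configs_blocks(3)[OF assms, of B] configs_blocks(3)[OF assms, of B'] by auto
qed

lemma rev_sorted_list_of_set_eq:
  fixes xs :: "nat list"
  assumes "sorted_wrt (>) xs"
  shows "rev (sorted_list_of_set (set xs)) = xs"
proof -
  have "sorted_wrt (<) (rev xs)" using assms by (simp add: sorted_wrt_rev)
  then have "sorted_list_of_set (set (rev xs)) = rev xs"
    by (intro sorted_list_of_set.idem_if_sorted_distinct) (auto simp: strict_sorted_iff)
  then show ?thesis by simp
qed

lemma stack_openers_list:
  "(C, Os) \<in> configs t \<Longrightarrow> rev (sorted_list_of_set (Min ` set Os)) = map Min Os"
  using rev_sorted_list_of_set_eq[OF stack_sorted] by simp

text \<open>The stack that was present when its current top block was created is the current one: the blocks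
created later have been closed without changing what lies below, and a block that was open at that
time and is closed by now would straddle a point of the top block.\<close>

lemma birth_stack_top:
  assumes "(C, B # Os) \<in> configs t"
  shows "birth_stack (C, B # Os) (Min B) = Min ` set (B # Os)"
proof -
  note blk = configs_blocks[OF assms]
  have "\<not> (Min D \<le> Min B \<and> Min B \<le> Max D)" if "D \<in> C" for D
  proof
    assume *: "Min D \<le> Min B \<and> Min B \<le> Max D"
    have "B \<noteq> D" using configs_top_fresh[OF assms] that by auto
    then have "Min B \<notin> D"
      using partition_on_eq_block[of "{1..t}" "C \<union> set (B # Os)" B D "Min B"] that assms
        blk(3)[of B] unfolding configs_def by auto
    then have "Min D < Min B" "Min B < Max D"
      using * blk(3,4)[of D] that by (auto simp: order.strict_iff_order)
    then show False
      using assms that blk(3)[of B] blk(3,4)[of D] unfolding configs_def by auto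
  qed
  moreover have "Min B' \<le> Min B" if "B' \<in> set Os" for B'
    using stack_sorted[OF assms] that by (auto simp: less_imp_le)
  ultimately show ?thesis by auto
qed

lemma Min_Max_grow:
  assumes "finite B" "B \<noteq> {}" "Max B \<le> t"
  shows "Min (insert (Suc t) B) = Min B" "Max (insert (Suc t) B) = Suc t"
proof -
  have "Min B \<le> t" using assms Max_ge[of B "Min B"] by (meson Min_in le_trans)
  then show "Min (insert (Suc t) B) = Min B" "Max (insert (Suc t) B) = Suc t"
    unfolding Min_insert[OF assms(1,2)] Max_insert[OF assms(1,2)] using assms(3) by linarith+
qed

lemma blocks_push: "blocks (push_block x c) = insert {x} (blocks c)"
  by (cases c) auto

lemma openers_extend_close:
  assumes "c \<in> open_configs t"
  shows "openers (extend_block (Suc t) c) = openers c" "openers (close_block (Suc t) c) = openers c"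
proof -
  obtain C B Os where c: "c = (C, B # Os)" using assms by (cases c) (auto simp: neq_Nil_conv)
  then have "(C, B # Os) \<in> configs t" using assms by auto
  then have "Min (insert (Suc t) B) = Min B"
    using Min_Max_grow(1)[OF configs_blocks(1,2,6)] by auto
  then show "openers (extend_block (Suc t) c) = openers c"
    "openers (close_block (Suc t) c) = openers c" using c by auto
qed

lemma birth_stack_extend_close:
  assumes "c \<in> open_configs t" "y \<le> t"
  shows "birth_stack (extend_block (Suc t) c) y = birth_stack c y"
    "birth_stack (close_block (Suc t) c) y = birth_stack c y"
proof -
  obtain C B Os where c: "c = (C, B # Os)" using assms by (cases c) (auto simp: neq_Nil_conv)
  then have "(C, B # Os) \<in> configs t" using assms by auto
  then have eq: "Min (insert (Suc t) B) = Min B" "Max (insert (Suc t) B) = Suc t"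
    using Min_Max_grow[OF configs_blocks(1,2,6)] by auto
  have "{A \<in> insert (insert (Suc t) B) X. P A} =
      {A \<in> X. P A} \<union> (if P (insert (Suc t) B) then {insert (Suc t) B} else {})" for X P
    by auto
  moreover have "{A \<in> insert B X. P A} = {A \<in> X. P A} \<union> (if P B then {B} else {})"
    for X :: "nat set set" and P
    by auto
  ultimately show "birth_stack (extend_block (Suc t) c) y = birth_stack c y"
    "birth_stack (close_block (Suc t) c) y = birth_stack c y"
    using assms(2) by (auto simp: c eq image_Un simp del: insert_iff)
qed

lemma v_labels_extend_close:
  assumes "c \<in> open_configs t"
  shows "v_labels N (extend_block (Suc t) c) = v_labels N c"
    "v_labels N (close_block (Suc t) c) = v_labels N c"
proof -
  have "x \<le> t" if "x \<in> openers c" for x using that assms openers_le by blast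
  then show "v_labels N (extend_block (Suc t) c) = v_labels N c"
    "v_labels N (close_block (Suc t) c) = v_labels N c"
    unfolding v_labels_def openers_extend_close[OF assms]
    using birth_stack_extend_close[OF assms] by auto
qed

lemma birth_stack_push:
  assumes "c \<in> configs t"
  shows "y \<le> t \<Longrightarrow> birth_stack (push_block (Suc t) c) y = birth_stack c y"
    "birth_stack (push_block (Suc t) c) (Suc t) = insert (Suc t) (Min ` set (snd c))"
proof -
  obtain C Os where c: "c = (C, Os)" by (cases c)
  note blk = configs_blocks[OF assms[unfolded c]]
  show "birth_stack (push_block (Suc t) c) y = birth_stack c y" if "y \<le> t"
    using that by (auto simp: c)
  have "\<not> Suc t \<le> Max D" if "D \<in> C" for D using blk(6)[of D] that by auto
  moreover have "Min B \<le> Suc t" if "B \<in> set Os" for B using blk(5)[of B] that by auto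
  ultimately have "{D \<in> C. Min D \<le> Suc t \<and> Suc t \<le> Max D} = {}"
    "{B \<in> set ({Suc t} # Os). Min B \<le> Suc t} = set ({Suc t} # Os)"
    by auto
  moreover have "birth_stack (push_block (Suc t) c) (Suc t) =
      Min ` ({D \<in> C. Min D \<le> Suc t \<and> Suc t \<le> Max D} \<union> {B \<in> set ({Suc t} # Os). Min B \<le> Suc t})"
    by (simp add: c)
  ultimately show "birth_stack (push_block (Suc t) c) (Suc t) = insert (Suc t) (Min ` set (snd c))"
    by (simp only: c) simp
qed

text \<open>The V-word condition imposed at the creation of the top block applies to the current stack
by \<open>birth_stack_top\<close>.\<close>

lemma stack_word_v_word:
  assumes "c \<in> configs t" "l \<in> v_labels N c"
  shows "v_word (stack_word c l)" "set (stack_word c l) \<subseteq> {1..N}"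
proof -
  obtain C Os where c: "c = (C, Os)" by (cases c)
  show "set (stack_word c l) \<subseteq> {1..N}"
    using assms(2) by (auto simp: v_labels_def stack_word_def c)
  show "v_word (stack_word c l)"
  proof (cases Os)
    case Nil
    then show ?thesis by (simp add: c stack_word_def)
  next
    case (Cons B Os')
    then have c': "(C, B # Os') \<in> configs t" using assms c by simp
    have "v_word (map l (rev (sorted_list_of_set (birth_stack c (Min B)))))"
      using assms(2) unfolding v_labels_def by (auto simp: c Cons)
    then show ?thesis
      unfolding c Cons birth_stack_top[OF c'] stack_openers_list[OF c']
      by (simp add: stack_word_def comp_def)
  qed
qed

lemma finite_v_labels: "c \<in> configs t \<Longrightarrow> finite (v_labels N c)"
  by (rule finite_subset[of _ "openers c \<rightarrow>\<^sub>E {1..N}"])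
    (auto simp: v_labels_def finite_blocks intro!: finite_PiE)

lemma PiE_insert_iff:
  assumes "x \<notin> A"
  shows "l \<in> insert x A \<rightarrow>\<^sub>E B \<longleftrightarrow> l(x := undefined) \<in> A \<rightarrow>\<^sub>E B \<and> l x \<in> B"
  using assms by (auto simp: PiE_iff extensional_def)

lemma v_labels_push_iff:
  assumes c: "c \<in> configs t"
  shows "l \<in> v_labels N (push_block (Suc t) c) \<longleftrightarrow>
    l(Suc t := undefined) \<in> v_labels N c \<and> l (Suc t) \<in> {1..N} \<and>
    v_word (l (Suc t) # stack_word c l)"
proof -
  let ?x = "Suc t" and ?l = "l(Suc t := undefined)"
  obtain C Os where cc: "c = (C, Os)" by (cases c)
  note le = openers_le[OF c]
  have x: "?x \<notin> openers c" using le[of ?x] by auto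
  have op: "openers (push_block ?x c) = insert ?x (openers c)" by (simp add: blocks_push)
  have "l \<in> insert ?x (openers c) \<rightarrow>\<^sub>E {1..N} \<longleftrightarrow>
      ?l \<in> openers c \<rightarrow>\<^sub>E {1..N} \<and> l ?x \<in> {1..N}"
    by (rule PiE_insert_iff[OF x])
  moreover have "v_word (map l (rev (sorted_list_of_set (birth_stack (push_block ?x c) y)))) \<longleftrightarrow>
      v_word (map ?l (rev (sorted_list_of_set (birth_stack c y))))" if "y \<in> openers c" for y
  proof -
    have "?x \<notin> set (rev (sorted_list_of_set (birth_stack c y)))"
      using x birth_stack_subset[of c y] finite_birth_stack[OF c, of y] by auto
    then have "map ?l (rev (sorted_list_of_set (birth_stack c y))) =
        map l (rev (sorted_list_of_set (birth_stack c y)))"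
      by (intro map_cong) auto
    then show ?thesis unfolding birth_stack_push(1)[OF c le[OF that]] by (simp only:)
  qed
  moreover have "map l (rev (sorted_list_of_set (birth_stack (push_block ?x c) ?x))) =
      l ?x # stack_word c l"
  proof -
    have "sorted_wrt (>) (?x # map Min Os)"
      using stack_sorted[OF c[unfolded cc]] configs_blocks(5)[OF c] by (auto simp: cc less_Suc_eq_le)
    from rev_sorted_list_of_set_eq[OF this]
    show ?thesis unfolding birth_stack_push(2)[OF c] by (simp add: cc stack_word_def comp_def)
  qed
  ultimately show ?thesis
    unfolding v_labels_def op by auto
qed

lemma stack_word_cong:
  assumes "\<And>x. x \<in> openers c \<Longrightarrow> l x = l' x"
  shows "stack_word c l = stack_word c l'"
  using assms by (cases c) (auto simp: stack_word_def)

text \<open>Creating a block with an arbitrary label \<open>i\<close> amounts to extending the labeling by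
one value. The sum over all \<open>i\<close> also has terms whose word is not a V-word, where the extended
labeling is not admissible; these are \<open>0\<close>, just as the basis vectors of such words are.\<close>

lemma sum_v_labels_push:
  fixes g :: "nat list \<Rightarrow> 'a::comm_monoid_add"
  assumes c: "c \<in> configs t" and g: "\<And>w. \<not> v_word w \<Longrightarrow> g w = 0"
  shows "(\<Sum>l\<in>v_labels N (push_block (Suc t) c). g (stack_word (push_block (Suc t) c) l)) =
    (\<Sum>l\<in>v_labels N c. \<Sum>i = 1..N. g (i # stack_word c l))"
proof -
  let ?x = "Suc t"
  have x: "?x \<notin> openers c" using openers_le[OF c, of ?x] by auto
  then have word: "stack_word c (l(?x := i)) = stack_word c l" for l i
    using x by (intro stack_word_cong) (metis fun_upd_other)
  have push: "stack_word (push_block ?x c) l = l ?x # stack_word c l" for l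
    by (cases c) (simp add: stack_word_def)
  have fin: "finite (v_labels N c)"
    by (rule finite_v_labels[OF c])
  let ?S = "{(l, i). l \<in> v_labels N c \<and> i \<in> {1..N} \<and> v_word (i # stack_word c l)}"
  have und: "l(?x := undefined) = l" if "l \<in> v_labels N c" for l
    using that x unfolding v_labels_def by (auto simp: PiE_iff extensional_def fun_eq_iff)
  have "(\<Sum>l\<in>v_labels N (push_block ?x c). g (stack_word (push_block ?x c) l)) =
      (\<Sum>(l, i)\<in>?S. g (i # stack_word c l))"
    by (rule sum.reindex_bij_witness[where i = "\<lambda>(l, i). l(?x := i)" and
          j = "\<lambda>l. (l(?x := undefined), l ?x)"])
      (auto simp: v_labels_push_iff[OF c] word push und)
  also have "\<dots> = (\<Sum>(l, i)\<in>v_labels N c \<times> {1..N}. g (i # stack_word c l))"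
    by (rule sum.mono_neutral_left) (use fin g in auto)
  also have "\<dots> = (\<Sum>l\<in>v_labels N c. \<Sum>i = 1..N. g (i # stack_word c l))"
    by (simp add: sum.cartesian_product)
  finally show ?thesis .
qed

section \<open>Powers of the sum operator on the vacuum\<close>

lemma linear_S_op: "linear (S_op N lam)"
proof -
  have "linear (\<lambda>f. \<Sum>i = 1..N. (creation i f + annihilation i f) /\<^sub>R sqrt (real N) +
      lam *\<^sub>R conservation i f)"
    by (intro linear_compose_sum linear_compose_add linear_compose_scale_right ballI
        bounded_linear.linear bounded_linear_creation bounded_linear_annihilation
        bounded_linear_conservation)
  then show ?thesis by (simp add: S_op_def[abs_def])
qed

text \<open>On a basis vector all labels of \<open>{1..N}\<close> contribute to creation, whereas exactly one summand of
annihilation and of conservation acts nontrivially, namely the one with the top letter.\<close>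

lemma S_op_basis:
  assumes "v_word w" "set w \<subseteq> {1..N}"
  shows "S_op N lam (fock_basis w) =
    (\<Sum>i = 1..N. (1 / sqrt N) *\<^sub>R fock_basis (i # w)) +
    (if w = [] then 0 else (1 / sqrt N) *\<^sub>R fock_basis (tl w) + lam *\<^sub>R fock_basis w)"
proof (cases w)
  case Nil
  then show ?thesis
    by (simp add: S_op_def creation_basis annihilation_vacuum conservation_vacuum divide_inverse_commute)
next
  case (Cons j v)
  have j: "j \<in> {1..N}" using assms(2) Cons by auto
  have "S_op N lam (fock_basis w) = (\<Sum>i = 1..N. (1 / sqrt N) *\<^sub>R fock_basis (i # w) +
      (if i = j then (1 / sqrt N) *\<^sub>R fock_basis v + lam *\<^sub>R fock_basis w else 0))"
    unfolding S_op_def using assms(1)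
    by (intro sum.cong refl)
      (auto simp: Cons creation_basis annihilation_basis conservation_basis scaleR_add_right
        inverse_eq_divide)
  also have "\<dots> = (\<Sum>i = 1..N. (1 / sqrt N) *\<^sub>R fock_basis (i # w)) +
      ((1 / sqrt N) *\<^sub>R fock_basis v + lam *\<^sub>R fock_basis w)"
    using j by (simp add: sum.distrib)
  finally show ?thesis by (simp add: Cons)
qed

text \<open>The points that begin a block, and the last points of the closed blocks. Each of them comes from a
creation or an annihilation operator, with factor \<open>1 / sqrt N\<close>; all other points come from
conservation operators, with factor \<open>lam\<close>.\<close>

fun points_used :: "config \<Rightarrow> nat" where
  "points_used (C, Os) = 2 * card C + length Os"

definition weight :: "nat \<Rightarrow> real \<Rightarrow> nat \<Rightarrow> config \<Rightarrow> real" where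
  "weight N lam t c = (1 / sqrt N) ^ points_used c * lam ^ (t - points_used c)"

lemma points_used_close:
  assumes "c \<in> open_configs t"
  shows "points_used (close_block (Suc t) c) = Suc (points_used c)"
proof -
  obtain C B Os where c: "c = (C, B # Os)" using assms by (cases c) (auto simp: neq_Nil_conv)
  then have cfg: "(C, B # Os) \<in> configs t" using assms by auto
  have "insert (Suc t) B \<notin> C" using configs_block_subset(4)[OF cfg, of "insert (Suc t) B"] by auto
  moreover have "finite C" using finite_blocks[OF cfg] by auto
  ultimately show ?thesis by (simp add: c)
qed

lemma points_used_push: "points_used (push_block x c) = Suc (points_used c)"
  by (cases c) auto

lemma points_used_extend: "snd c \<noteq> [] \<Longrightarrow> points_used (extend_block x c) = points_used c"
  by (cases c) auto

lemma points_used_le: "c \<in> configs t \<Longrightarrow> points_used c \<le> t"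
proof (induction t arbitrary: c)
  case 0
  then show ?case by (auto simp: configs_def partition_on_empty)
next
  case (Suc t)
  then show ?case
    unfolding configs_Suc
    using points_used_close[of _ t] points_used_push points_used_extend
    by (auto simp: le_SucI)
qed

lemma weight_simps:
  "weight N lam (Suc t) (push_block (Suc t) c) = weight N lam t c * (1 / sqrt N)"
  "c \<in> open_configs t \<Longrightarrow> weight N lam (Suc t) (extend_block (Suc t) c) = weight N lam t c * lam"
  "c \<in> open_configs t \<Longrightarrow>
    weight N lam (Suc t) (close_block (Suc t) c) = weight N lam t c * (1 / sqrt N)"
  using points_used_le[of c t]
  by (simp_all add: weight_def points_used_push points_used_extend points_used_close Suc_diff_le)

lemma inj_on_push_block: "inj_on (push_block x) S"
  by (auto simp: inj_on_def)

lemma inj_on_extend_block: "inj_on (extend_block (Suc t)) (open_configs t)"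
proof (rule inj_onI)
  fix c c' assume *: "c \<in> open_configs t" "c' \<in> open_configs t"
    "extend_block (Suc t) c = extend_block (Suc t) c'"
  obtain C B Os where c: "c = (C, B # Os)" using * by (cases c) (auto simp: neq_Nil_conv)
  obtain C' B' Os' where c': "c' = (C', B' # Os')" using * by (cases c') (auto simp: neq_Nil_conv)
  have "Suc t \<notin> B" "Suc t \<notin> B'"
    using configs_block_subset(4)[of C "B # Os" t B] configs_block_subset(4)[of C' "B' # Os'" t B']
      * by (auto simp: c c')
  then show "c = c'" using *(3) by (simp add: c c' insert_ident)
qed

lemma inj_on_close_block: "inj_on (close_block (Suc t)) (open_configs t)"
proof (rule inj_onI)
  fix c c' assume *: "c \<in> open_configs t" "c' \<in> open_configs t"
    "close_block (Suc t) c = close_block (Suc t) c'"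
  obtain C B Os where c: "c = (C, B # Os)" using * by (cases c) (auto simp: neq_Nil_conv)
  obtain C' B' Os' where c': "c' = (C', B' # Os')" using * by (cases c') (auto simp: neq_Nil_conv)
  have cfg: "(C, B # Os) \<in> configs t" "(C', B' # Os') \<in> configs t" using * by (auto simp: c c')
  note nin = configs_block_subset(4)[OF cfg(1)] configs_block_subset(4)[OF cfg(2)]
  have eq: "insert (insert (Suc t) B) C = insert (insert (Suc t) B') C'" using *(3) by (simp add: c c')
  have "insert (Suc t) B \<notin> C" "insert (Suc t) B \<notin> C'" "insert (Suc t) B' \<notin> C'"
    using nin(1)[of "insert (Suc t) B"] nin(2)[of "insert (Suc t) B"]
      nin(2)[of "insert (Suc t) B'"] by auto
  then have "insert (Suc t) B = insert (Suc t) B'" "C = C'"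
    using eq by (metis insertE insertI1, metis eq insertE insertI1 insert_ident)
  moreover have "Suc t \<notin> B" "Suc t \<notin> B'" using nin(1)[of B] nin(2)[of B'] by auto
  ultimately show "c = c'" using *(3) by (simp add: c c' insert_ident)
qed

text \<open>A configuration reveals the last step: the last point is alone in an open block, in an open block
with further points, or in a closed block.\<close>

lemma configs_images_disjoint:
  "push_block (Suc t) ` configs t \<inter> extend_block (Suc t) ` open_configs t = {}"
  "(push_block (Suc t) ` configs t \<union> extend_block (Suc t) ` open_configs t) \<inter>
    close_block (Suc t) ` open_configs t = {}"
proof -
  show "push_block (Suc t) ` configs t \<inter> extend_block (Suc t) ` open_configs t = {}"
  proof -
    have "push_block (Suc t) c \<noteq> extend_block (Suc t) c'" if open': "c' \<in> open_configs t" for c c'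
    proof -
      obtain C B Os where c': "c' = (C, B # Os)" using open' by (cases c') (auto simp: neq_Nil_conv)
      then have "B \<noteq> {}" "Suc t \<notin> B"
        using configs_block_subset(2,4)[of C "B # Os" t B] open' by auto
      then have "insert (Suc t) B \<noteq> {Suc t}" by auto
      then show ?thesis by (cases c) (auto simp: c')
    qed
    then show ?thesis by blast
  qed
  have fst: "fst (push_block x c) = fst c" "fst (extend_block x c) = fst c" for x c
    by (cases c; simp)+
  have old: "\<forall>D\<in>fst c'. Suc t \<notin> D"
    if c': "c' \<in> push_block (Suc t) ` configs t \<union> extend_block (Suc t) ` open_configs t" for c'
  proof -
    obtain c where c: "c \<in> configs t" "c' = push_block (Suc t) c \<or> c' = extend_block (Suc t) c"
      using c' by blast
    then have "fst c' = fst c" using fst by metis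
    then show ?thesis using configs_block_subset(4)[of "fst c" "snd c" t] c(1) by auto
  qed
  have close: "\<exists>D\<in>fst (close_block (Suc t) c). Suc t \<in> D" for c
    by (cases c) auto
  show "(push_block (Suc t) ` configs t \<union> extend_block (Suc t) ` open_configs t) \<inter>
    close_block (Suc t) ` open_configs t = {}"
  proof (intro equals0I)
    fix c' assume c': "c' \<in> (push_block (Suc t) ` configs t \<union> extend_block (Suc t) ` open_configs t) \<inter>
      close_block (Suc t) ` open_configs t"
    then obtain c where c: "c' = close_block (Suc t) c" by (elim IntE imageE)
    have "\<forall>D\<in>fst c'. Suc t \<notin> D" by (rule old[OF IntD1[OF c']])
    with close[of c] show False unfolding c by (elim bexE) (drule (1) bspec, erule (1) notE)
  qed
qed

lemma sum_configs_Suc: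
  fixes g :: "config \<Rightarrow> 'a::comm_monoid_add"
  shows "(\<Sum>c\<in>configs (Suc t). g c) = (\<Sum>c\<in>configs t. g (push_block (Suc t) c)) +
    (\<Sum>c\<in>open_configs t. g (extend_block (Suc t) c)) +
    (\<Sum>c\<in>open_configs t. g (close_block (Suc t) c))"
  unfolding configs_Suc using finite_configs[of t] configs_images_disjoint[of t]
  by (subst sum.union_disjoint, simp, simp, simp)+
    (simp add: sum.reindex inj_on_push_block inj_on_extend_block inj_on_close_block)

lemma stack_word_extend_close:
  assumes "c \<in> open_configs t"
  shows "stack_word (extend_block (Suc t) c) l = stack_word c l"
    "stack_word (close_block (Suc t) c) l = tl (stack_word c l)"
proof -
  obtain C B Os where c: "c = (C, B # Os)" using assms by (cases c) (auto simp: neq_Nil_conv)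
  then have "(C, B # Os) \<in> configs t" using assms by auto
  then have "Min (insert (Suc t) B) = Min B"
    using Min_Max_grow(1)[OF configs_blocks(1,2,6)] by auto
  then show "stack_word (extend_block (Suc t) c) l = stack_word c l"
    "stack_word (close_block (Suc t) c) l = tl (stack_word c l)"
    by (simp_all add: stack_word_def c)
qed

definition labelled_vector :: "nat \<Rightarrow> real \<Rightarrow> nat \<Rightarrow> config \<Rightarrow> fock" where
  "labelled_vector N lam t c =
     weight N lam t c *\<^sub>R (\<Sum>l\<in>v_labels N c. fock_basis (stack_word c l))"

text \<open>The creation, conservation and annihilation parts of the sum operator perform the three steps
of the scan.\<close>

lemma S_op_labelled_vector:
  assumes c: "c \<in> configs t"
  shows "S_op N lam (labelled_vector N lam t c) =
    labelled_vector N lam (Suc t) (push_block (Suc t) c) +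
    (if snd c = [] then 0 else labelled_vector N lam (Suc t) (extend_block (Suc t) c) +
       labelled_vector N lam (Suc t) (close_block (Suc t) c))"
proof -
  have nil: "stack_word c l = [] \<longleftrightarrow> snd c = []" for l by (simp add: stack_word_def)
  have "S_op N lam (labelled_vector N lam t c) =
      weight N lam t c *\<^sub>R (\<Sum>l\<in>v_labels N c. S_op N lam (fock_basis (stack_word c l)))"
    by (simp add: labelled_vector_def linear_cmul[OF linear_S_op] linear_sum[OF linear_S_op])
  also have "(\<Sum>l\<in>v_labels N c. S_op N lam (fock_basis (stack_word c l))) =
      (\<Sum>l\<in>v_labels N c. \<Sum>i = 1..N. (1 / sqrt N) *\<^sub>R fock_basis (i # stack_word c l)) +
      (if snd c = [] then 0 else
        (\<Sum>l\<in>v_labels N c. (1 / sqrt N) *\<^sub>R fock_basis (tl (stack_word c l))) +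
        (\<Sum>l\<in>v_labels N c. lam *\<^sub>R fock_basis (stack_word c l)))"
    using stack_word_v_word[OF c]
    by (simp add: S_op_basis nil sum.distrib cong: sum.cong)
  also have "(\<Sum>l\<in>v_labels N c. \<Sum>i = 1..N. (1 / sqrt N) *\<^sub>R fock_basis (i # stack_word c l)) =
      (\<Sum>l\<in>v_labels N (push_block (Suc t) c).
        (1 / sqrt N) *\<^sub>R fock_basis (stack_word (push_block (Suc t) c) l))"
    by (rule sum_v_labels_push[OF c, symmetric]) simp
  finally show ?thesis
    using c unfolding labelled_vector_def
    by (auto simp: weight_simps v_labels_extend_close[of c t] stack_word_extend_close[of c t]
        scaleR_add_right simp flip: scaleR_sum_right)
qed

lemma S_op_power_vacuum:
  "(S_op N lam ^^ t) \<Omega> = (\<Sum>c\<in>configs t. labelled_vector N lam t c)"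
proof (induction t)
  case 0
  have "configs 0 = {({}, [])}"
    by (auto simp: configs_def partition_on_empty noncrossing_def)
  then show ?case
    by (simp add: labelled_vector_def weight_def v_labels_def stack_word_def)
next
  case (Suc t)
  have "(S_op N lam ^^ Suc t) \<Omega> = (\<Sum>c\<in>configs t. S_op N lam (labelled_vector N lam t c))"
    using Suc.IH by (simp add: linear_sum[OF linear_S_op])
  also have "\<dots> = (\<Sum>c\<in>configs t. labelled_vector N lam (Suc t) (push_block (Suc t) c)) +
      (\<Sum>c\<in>configs t. if snd c = [] then 0 else
        labelled_vector N lam (Suc t) (extend_block (Suc t) c) +
        labelled_vector N lam (Suc t) (close_block (Suc t) c))"
    by (simp add: S_op_labelled_vector sum.distrib cong: sum.cong)
  also have "(\<Sum>c\<in>configs t. if snd c = [] then 0 else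
        labelled_vector N lam (Suc t) (extend_block (Suc t) c) +
        labelled_vector N lam (Suc t) (close_block (Suc t) c)) =
      (\<Sum>c\<in>open_configs t. labelled_vector N lam (Suc t) (extend_block (Suc t) c) +
        labelled_vector N lam (Suc t) (close_block (Suc t) c))"
    using finite_configs[of t] by (simp add: sum.If_cases Int_def Collect_neg_eq)
  finally show ?case by (simp add: sum_configs_Suc sum.distrib add.assoc)
qed

lemma configs_closed_iff: "(C, []) \<in> configs n \<longleftrightarrow> C \<in> NC2plus n"
  by (auto simp: configs_def NC2plus_def)

text \<open>The vacuum coefficient selects the configurations with an empty stack, which are the noncrossing
partitions without singletons. For these, the number of factors \<open>1 / sqrt N\<close> is twice the number
of blocks.\<close>

lemma vacuum_moment:
  "vacuum_state (S_op N lam ^^ n) = complex_of_real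
     (\<Sum>P\<in>NC2plus n. card (v_labels N (P, [])) / real N ^ card P * lam ^ (n - 2 * card P))"
proof -
  have coef0: "coef (fock_basis w) [] = (if w = [] then 1 else 0)" for w
    by (auto simp: fock_basis.rep_eq)
  have "vacuum_state (S_op N lam ^^ n) = (\<Sum>c\<in>configs n. coef (labelled_vector N lam n c) [])"
    by (simp add: vacuum_state_def cinner_fock_basis S_op_power_vacuum coef_sum)
  also have "\<dots> = (\<Sum>c\<in>configs n. if snd c = [] then
      complex_of_real (card (v_labels N c) * weight N lam n c) else 0)"
    by (intro sum.cong refl)
      (simp add: labelled_vector_def coef_sum coef0 stack_word_def)
  also have "\<dots> = (\<Sum>P\<in>NC2plus n. complex_of_real (card (v_labels N (P, [])) * weight N lam n (P, [])))"
    unfolding sum.inter_filter[OF finite_configs, symmetric]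
    by (rule sum.reindex_bij_witness[where i = "\<lambda>P. (P, [])" and j = fst])
      (auto simp: configs_closed_iff)
  also have "\<dots> = complex_of_real
     (\<Sum>P\<in>NC2plus n. card (v_labels N (P, [])) / real N ^ card P * lam ^ (n - 2 * card P))"
    by (simp add: weight_def power_divide power_mult real_sqrt_pow2)
  finally show ?thesis .
qed

section \<open>V-monotonicity read off from the surrounding blocks\<close>

lemma v_word_append_right: "v_word (u @ w) \<Longrightarrow> v_word w"
  by (induction u) (auto dest: v_word_ConsD)

lemma finite_NC2plus: "finite (NC2plus n)"
  by (rule finite_subset[of _ "Pow (Pow {1..n})"]) (auto simp: NC2plus_def partition_on_def)

lemma nc_blocks:
  assumes "P \<in> NC2plus n" "B \<in> P"
  shows "finite B" "B \<noteq> {}" "Min B \<in> B" "Max B \<in> B"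
  using configs_blocks[of "(P, [])" n B] assms by (simp_all add: configs_closed_iff)

lemma finite_nc: "P \<in> NC2plus n \<Longrightarrow> finite P"
  using finite_blocks[of "(P, [])" n] by (simp add: configs_closed_iff)

lemma nc_eq_block:
  assumes "P \<in> NC2plus n" "B \<in> P" "D \<in> P" "x \<in> B" "x \<in> D"
  shows "B = D"
  using partition_on_eq_block[of "{1..n}" P B D x] assms by (simp add: NC2plus_def)

lemma inj_on_Min_nc: "P \<in> NC2plus n \<Longrightarrow> inj_on Min P"
  using nc_blocks(3) nc_eq_block by (metis inj_onI)

text \<open>In a noncrossing partition a block that starts within the range of \<open>B'\<close> also ends in the same gap
of \<open>B'\<close>; so the nesting order can be tested at the first point of the inner block alone.\<close>

lemma block_less_iff:
  assumes P: "P \<in> NC2plus n" and B: "B' \<in> P" "B \<in> P"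
  shows "block_less B' B \<longleftrightarrow> Min B' < Min B \<and> Min B \<le> Max B'"
proof
  note blk = nc_blocks[OF P]
  show "Min B' < Min B \<and> Min B \<le> Max B'" if less: "block_less B' B"
  proof -
    obtain a b where ab: "a \<in> B'" "b \<in> B'" "a < Min B" "Max B < b"
      using less unfolding block_less_def by auto
    have "Min B' \<le> a" "b \<le> Max B'" "Min B \<le> Max B" using ab blk(1,3)[OF B(1)] blk(1,3)[OF B(2)] by auto
    then show ?thesis using ab by linarith
  qed
  assume *: "Min B' < Min B \<and> Min B \<le> Max B'"
  then have "B' \<noteq> B" by auto
  then have disj: "x \<notin> B" if "x \<in> B'" for x using nc_eq_block[OF P B that] by blast
  \<comment> \<open>The gap of the outer block around the first point of the inner block.\<close>
  let ?lo = "{x \<in> B'. x < Min B}" and ?hi = "{x \<in> B'. Min B < x}"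
  have fin: "finite ?lo" "finite ?hi" using blk(1)[OF B(1)] by auto
  have "Min B' \<in> ?lo" using * blk(3)[OF B(1)] by auto
  then have lo: "Max ?lo \<in> ?lo" by (intro Max_in fin) blast
  have "Max B' \<noteq> Min B" using disj[OF blk(4)[OF B(1)]] blk(3)[OF B(2)] by auto
  then have "Max B' \<in> ?hi" using * blk(4)[OF B(1)] by auto
  then have hi: "Min ?hi \<in> ?hi" by (intro Min_in fin) blast
  have "B' \<inter> {Max ?lo<..<Min ?hi} = {}"
  proof (intro equals0I)
    fix x assume x: "x \<in> B' \<inter> {Max ?lo<..<Min ?hi}"
    then have "x \<noteq> Min B" using disj blk(3)[OF B(2)] by auto
    then consider "x \<in> ?lo" | "x \<in> ?hi" using x by fastforce
    then have "x \<le> Max ?lo \<or> Min ?hi \<le> x"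
      using Max_ge[OF fin(1)] Min_le[OF fin(2)] by cases blast+
    then show False using x by auto
  qed
  moreover have "Max B < Min ?hi"
  proof (rule ccontr)
    assume "\<not> Max B < Min ?hi"
    moreover have "Max B \<noteq> Min ?hi" using hi disj blk(4)[OF B(2)] by auto
    ultimately have "Min ?hi < Max B" by simp
    moreover have "noncrossing P" using P by (simp add: NC2plus_def)
    ultimately show False
      using lo hi blk(3,4)[OF B(2)] B \<open>B' \<noteq> B\<close> unfolding noncrossing_def by blast
  qed
  moreover have "Max ?lo < Min ?hi" using lo hi by auto
  ultimately show "block_less B' B" unfolding block_less_def using lo hi by blast
qed

text \<open>For \<open>P\<close> in \<open>NC2plus n\<close> this is the principal down-set of \<open>B\<close> for the nesting order, with \<open>B\<close>
itself included; equivalently, the blocks that are open just after the first point of \<open>B\<close>.\<close>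

definition surrounding :: "nat set set \<Rightarrow> nat set \<Rightarrow> nat set set" where
  "surrounding P B = {D \<in> P. Min D \<le> Min B \<and> Min B \<le> Max D}"

lemma surrounding_block_less:
  assumes P: "P \<in> NC2plus n" and B: "D \<in> surrounding P B" "D' \<in> surrounding P B"
    and less: "Min D < Min D'"
  shows "block_less D D'"
  using assms block_less_iff[OF P, of D D'] by (auto simp: surrounding_def)

lemma chain_surrounding:
  assumes P: "P \<in> NC2plus n"
  shows "pred_on.chain P block_less (surrounding P B)"
proof -
  have "D = D' \<or> block_less D D' \<or> block_less D' D"
    if "D \<in> surrounding P B" "D' \<in> surrounding P B" for D D'
  proof (cases "Min D" "Min D'" rule: linorder_cases)
    case equal
    then have "D = D'" using that inj_on_Min_nc[OF P] by (auto simp: surrounding_def dest: inj_onD)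
    then show ?thesis by simp
  qed (use surrounding_block_less[OF P] that in auto)
  then show ?thesis unfolding pred_on.chain_def by (auto simp: surrounding_def)
qed

lemma chain_block_less:
  assumes P: "P \<in> NC2plus n" and M: "pred_on.chain P block_less M"
    and D: "D \<in> M" "D' \<in> M" and less: "Min D < Min D'"
  shows "block_less D D'"
proof -
  have "D \<in> P" "D' \<in> P" "D = D' \<or> block_less D D' \<or> block_less D' D"
    using M D unfolding pred_on.chain_def by auto
  then show ?thesis using block_less_iff[OF P, of D' D] less by auto
qed

text \<open>Below a member \<open>B\<close> of a chain there are only blocks surrounding \<open>B\<close>, as the order of the first
points decides which of two comparable blocks is the outer one.\<close>

lemma chain_restrict_surrounding:
  assumes P: "P \<in> NC2plus n" and M: "pred_on.chain P block_less M" and B: "B \<in> M"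
  shows "{D \<in> M. Min D \<le> Min B} \<subseteq> surrounding P B"
proof
  fix D assume D: "D \<in> {D \<in> M. Min D \<le> Min B}"
  have MP: "D \<in> P" "B \<in> P" using M D B unfolding pred_on.chain_def by auto
  note blk = nc_blocks[OF P]
  show "D \<in> surrounding P B"
  proof (cases "Min D = Min B")
    case True
    then show ?thesis using MP blk(1,3)[OF MP(1)] by (auto simp: surrounding_def)
  next
    case False
    then have "block_less D B" using chain_block_less[OF P M _ B, of D] D by auto
    then show ?thesis using block_less_iff[OF P MP] MP by (auto simp: surrounding_def)
  qed
qed

lemma maxchain_extends:
  assumes "finite P" "pred_on.chain P R S"
  obtains M where "S \<subseteq> M" "pred_on.maxchain P R M"
proof -
  let ?X = "{M. pred_on.chain P R M \<and> S \<subseteq> M}"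
  have "?X \<subseteq> Pow P" unfolding pred_on.chain_def by auto
  then have "finite ?X" using assms(1) finite_subset by blast
  then obtain M where M: "M \<in> ?X" "\<And>M'. M' \<in> ?X \<Longrightarrow> M \<subseteq> M' \<Longrightarrow> M = M'"
    using finite_has_maximal2[of ?X S] assms(2) by auto
  then have "pred_on.maxchain P R M"
    unfolding pred_on.maxchain_def by (auto simp: psubset_eq)
  then show ?thesis using that M(1) by blast
qed

lemma sorted_list_of_set_split:
  fixes A :: "nat set"
  assumes "finite A"
  shows "sorted_list_of_set A =
    sorted_list_of_set {y \<in> A. y \<le> x} @ sorted_list_of_set {y \<in> A. x < y}"
proof -
  let ?xs = "sorted_list_of_set {y \<in> A. y \<le> x} @ sorted_list_of_set {y \<in> A. x < y}"
  have "sorted_wrt (<) ?xs" using assms by (auto simp: sorted_wrt_append)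
  then have "sorted_list_of_set (set ?xs) = ?xs"
    by (intro sorted_list_of_set.idem_if_sorted_distinct) (auto simp: strict_sorted_iff)
  moreover have "set ?xs = A" using assms by auto
  ultimately show ?thesis by simp
qed

text \<open>The blocks surrounding \<open>B\<close> form a chain. If it is extended to a maximal chain, its word becomes a
suffix of the word of the maximal chain, and suffixes of V-words are V-words. Conversely, a maximal
chain with innermost block \<open>B\<close> contains every block that surrounds \<open>B\<close>.\<close>

lemma v_monotone_iff:
  assumes P: "P \<in> NC2plus n"
  shows "v_monotone P (l \<circ> Min) \<longleftrightarrow>
    (\<forall>B\<in>P. v_word (map l (rev (sorted_list_of_set (Min ` surrounding P B)))))" (is "_ \<longleftrightarrow> ?R")
proof
  assume mono: "v_monotone P (l \<circ> Min)"
  show ?R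
  proof
    fix B assume B: "B \<in> P"
    obtain M where M: "surrounding P B \<subseteq> M" "pred_on.maxchain P block_less M"
      using maxchain_extends[OF finite_nc[OF P] chain_surrounding[OF P]] .
    have ch: "pred_on.chain P block_less M" using M(2) unfolding pred_on.maxchain_def by auto
    then have MP: "M \<subseteq> P" unfolding pred_on.chain_def by auto
    have fin: "finite M" using MP finite_nc[OF P] finite_subset by blast
    have inj: "inj_on Min M" using inj_on_Min_nc[OF P] MP inj_on_subset by blast
    define C where "C = map (the_inv_into M Min) (sorted_list_of_set (Min ` M))"
    have setC: "set C = M"
      using fin inj by (simp add: C_def image_image the_inv_into_f_f cong: image_cong)
    have mapC: "map Min C = sorted_list_of_set (Min ` M)"
      unfolding C_def map_map using fin inj
      by (intro map_idI) (auto simp: f_the_inv_into_f)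
    have "sorted_wrt (<) (map Min C)" unfolding mapC by simp
    then have "sorted_wrt (\<lambda>D D'. Min D < Min D') C" by (simp add: sorted_wrt_map)
    then have "sorted_wrt block_less C"
      by (rule sorted_wrt_mono_rel[rotated]) (auto simp: setC intro: chain_block_less[OF P ch])
    then have "v_word (rev (map (l \<circ> Min) C))"
      using mono M(2) unfolding v_monotone_def setC[symmetric] by blast
    moreover have "rev (map (l \<circ> Min) C) = map l (rev (sorted_list_of_set (Min ` M)))"
      unfolding mapC[symmetric] by (simp add: rev_map)
    ultimately have "v_word (map l (rev (sorted_list_of_set (Min ` M))))" by simp
    moreover have "{y \<in> Min ` M. y \<le> Min B} = Min ` surrounding P B"
    proof -
      have BM: "B \<in> M" using M(1) B nc_blocks(1,3)[OF P B] by (auto simp: surrounding_def)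
      have "{D \<in> M. Min D \<le> Min B} = surrounding P B"
        using chain_restrict_surrounding[OF P ch BM] M(1) by (auto simp: surrounding_def)
      then show ?thesis by blast
    qed
    ultimately show "v_word (map l (rev (sorted_list_of_set (Min ` surrounding P B))))"
      using sorted_list_of_set_split[of "Min ` M" "Min B"] fin v_word_append_right by auto
  qed
next
  assume R: ?R
  show "v_monotone P (l \<circ> Min)"
    unfolding v_monotone_def
  proof (intro allI impI, elim conjE)
    fix C assume srt: "sorted_wrt block_less C" and max: "pred_on.maxchain P block_less (set C)"
    have ch: "pred_on.chain P block_less (set C)" using max unfolding pred_on.maxchain_def by auto
    then have CP: "set C \<subseteq> P" unfolding pred_on.chain_def by auto
    show "v_word (rev (map (l \<circ> Min) C))"
    proof (cases C rule: rev_cases)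
      case (snoc C' B)
      have B: "B \<in> P" using CP snoc by auto
      have "\<forall>D\<in>set C'. block_less D B" using srt snoc by (simp add: sorted_wrt_append)
      then have "Min D \<le> Min B" if "D \<in> set C" for D
        using that block_less_iff[OF P _ B, of D] CP by (fastforce simp: snoc)
      then have "set C \<subseteq> surrounding P B"
        using chain_restrict_surrounding[OF P ch, of B] snoc by auto
      then have eq: "set C = surrounding P B"
        using max chain_surrounding[OF P, of B] unfolding pred_on.maxchain_def by auto
      have "sorted_wrt (\<lambda>D D'. Min D < Min D') C"
        by (rule sorted_wrt_mono_rel[OF _ srt]) (use block_less_iff[OF P] CP in auto)
      then have "sorted_wrt (<) (map Min C)" by (simp add: sorted_wrt_map)
      then have "sorted_list_of_set (set (map Min C)) = map Min C"
        by (intro sorted_list_of_set.idem_if_sorted_distinct) (auto simp: strict_sorted_iff)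
      then have "sorted_list_of_set (Min ` surrounding P B) = map Min C" by (simp add: eq)
      then show ?thesis using R B by (metis map_map rev_map)
    qed simp
  qed
qed

lemma v_monotone_cong:
  assumes "\<And>B. B \<in> P \<Longrightarrow> L B = L' B"
  shows "v_monotone P L \<longleftrightarrow> v_monotone P L'"
proof -
  have "map L C = map L' C" if "pred_on.maxchain P block_less (set C)" for C
    using that assms unfolding pred_on.maxchain_def pred_on.chain_def by (intro map_cong) auto
  then show ?thesis unfolding v_monotone_def by metis
qed

lemma v_labels_closed:
  assumes P: "P \<in> NC2plus n"
  shows "v_labels N (P, []) = {l \<in> Min ` P \<rightarrow>\<^sub>E {1..N}. v_monotone P (l \<circ> Min)}"
proof -
  have "birth_stack (P, []) (Min B) = Min ` surrounding P B" for B
    by (simp add: surrounding_def)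
  then show ?thesis unfolding v_labels_def v_monotone_iff[OF P] by simp
qed

lemma card_v_labels_closed:
  assumes P: "P \<in> NC2plus n"
  shows "card (v_labels N (P, [])) = card {L \<in> P \<rightarrow>\<^sub>E {1..N}. v_monotone P L}"
proof -
  note inj = inj_on_Min_nc[OF P]
  have "bij_betw (\<lambda>l. restrict (l \<circ> Min) P) (v_labels N (P, [])) {L \<in> P \<rightarrow>\<^sub>E {1..N}. v_monotone P L}"
    unfolding v_labels_closed[OF P]
  proof (rule bij_betw_byWitness[where f' = "\<lambda>L. restrict (L \<circ> the_inv_into P Min) (Min ` P)"])
    show "(\<lambda>l. restrict (l \<circ> Min) P) ` {l \<in> Min ` P \<rightarrow>\<^sub>E {1..N}. v_monotone P (l \<circ> Min)}
        \<subseteq> {L \<in> P \<rightarrow>\<^sub>E {1..N}. v_monotone P L}"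
    proof (intro image_subsetI)
      fix l assume l: "l \<in> {l \<in> Min ` P \<rightarrow>\<^sub>E {1..N}. v_monotone P (l \<circ> Min)}"
      have "v_monotone P (restrict (l \<circ> Min) P) \<longleftrightarrow> v_monotone P (l \<circ> Min)"
        by (rule v_monotone_cong) simp
      with l show "restrict (l \<circ> Min) P \<in> {L \<in> P \<rightarrow>\<^sub>E {1..N}. v_monotone P L}"
        by (auto simp: PiE_iff)
    qed
    show "(\<lambda>L. restrict (L \<circ> the_inv_into P Min) (Min ` P)) ` {L \<in> P \<rightarrow>\<^sub>E {1..N}. v_monotone P L}
        \<subseteq> {l \<in> Min ` P \<rightarrow>\<^sub>E {1..N}. v_monotone P (l \<circ> Min)}"
    proof (intro image_subsetI)
      fix L assume L: "L \<in> {L \<in> P \<rightarrow>\<^sub>E {1..N}. v_monotone P L}"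
      have "v_monotone P (restrict (L \<circ> the_inv_into P Min) (Min ` P) \<circ> Min) \<longleftrightarrow> v_monotone P L"
        by (rule v_monotone_cong) (simp add: the_inv_into_f_f[OF inj])
      with L show "restrict (L \<circ> the_inv_into P Min) (Min ` P)
          \<in> {l \<in> Min ` P \<rightarrow>\<^sub>E {1..N}. v_monotone P (l \<circ> Min)}"
        by (auto simp: PiE_iff the_inv_into_f_f[OF inj])
    qed
  qed (auto simp: fun_eq_iff the_inv_into_f_f[OF inj] PiE_iff extensional_def)
  then show ?thesis by (rule bij_betw_same_card)
qed

section \<open>Labelings with many labels\<close>

lemma sorted_wrt_map_strict_mono:
  fixes f :: "nat \<Rightarrow> nat"
  assumes "strict_mono_on S f" "set w \<subseteq> S"
  shows "sorted_wrt (<) (map f w) \<longleftrightarrow> sorted_wrt (<) w" "sorted_wrt (>) (map f w) \<longleftrightarrow> sorted_wrt (>) w"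
proof -
  have *: "f x < f y \<longleftrightarrow> x < y" if "x \<in> set w" "y \<in> set w" for x y
    using assms that strict_mono_on_less[OF assms(1)] by blast
  show "sorted_wrt (<) (map f w) \<longleftrightarrow> sorted_wrt (<) w" "sorted_wrt (>) (map f w) \<longleftrightarrow> sorted_wrt (>) w"
    unfolding sorted_wrt_map using * by (auto elim!: sorted_wrt_mono_rel[rotated])
qed

text \<open>Being a V-word depends on the relative order of the letters only. This is what makes the number of
V-monotone injective labelings with a given image depend only on the size of the image.\<close>

lemma v_word_map_strict_mono:
  assumes "strict_mono_on S f" "set w \<subseteq> S"
  shows "v_word (map f w) \<longleftrightarrow> v_word w"
proof -
  have "sorted_wrt (>) (map f (take m w)) \<longleftrightarrow> sorted_wrt (>) (take m w)" for m
    using assms(2) set_take_subset[of m w] by (intro sorted_wrt_map_strict_mono[OF assms(1)]) auto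
  moreover have "sorted_wrt (<) (map f (drop m w)) \<longleftrightarrow> sorted_wrt (<) (drop m w)" for m
    using assms(2) set_drop_subset[of m w] by (intro sorted_wrt_map_strict_mono[OF assms(1)]) auto
  ultimately show ?thesis unfolding v_word_def take_map drop_map by simp
qed

lemma v_monotone_strict_mono:
  assumes "strict_mono_on (L ` P) f"
  shows "v_monotone P (f \<circ> L) \<longleftrightarrow> v_monotone P L"
proof -
  have "v_word (rev (map (f \<circ> L) C)) \<longleftrightarrow> v_word (rev (map L C))"
    if "pred_on.maxchain P block_less (set C)" for C
  proof -
    have "set (rev (map L C)) \<subseteq> L ` P"
      using that unfolding pred_on.maxchain_def pred_on.chain_def by auto
    from v_word_map_strict_mono[OF assms this] show ?thesis by (simp add: rev_map)
  qed
  then show ?thesis unfolding v_monotone_def by metis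
qed

definition inj_labellings :: "'a set \<Rightarrow> (('a \<Rightarrow> nat) \<Rightarrow> bool) \<Rightarrow> nat \<Rightarrow> ('a \<Rightarrow> nat) set" where
  "inj_labellings D Q N = {L \<in> D \<rightarrow>\<^sub>E {1..N}. inj_on L D \<and> Q L}"

text \<open>Composition with the increasing bijection \<open>e\<close> from \<open>{1..card D}\<close> to the image \<open>A\<close>.\<close>

lemma card_inj_labellings_onto:
  fixes Q :: "('a \<Rightarrow> nat) \<Rightarrow> bool"
  assumes fin: "finite D"
    and cong: "\<And>L L'. (\<And>x. x \<in> D \<Longrightarrow> L x = L' x) \<Longrightarrow> Q L \<longleftrightarrow> Q L'"
    and mono: "\<And>L f. strict_mono_on (L ` D) f \<Longrightarrow> Q (f \<circ> L) \<longleftrightarrow> Q L"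
    and A: "A \<subseteq> {1..N}" "card A = card D"
  shows "card {L \<in> inj_labellings D Q N. L ` D = A} = card (inj_labellings D Q (card D))"
proof -
  let ?k = "card D"
  have finA: "finite A" using A(1) finite_subset by blast
  obtain h where h: "bij_betw h {..<?k} A" "strict_mono_on {..<?k} h"
    using ex_bij_betw_strict_mono_card[OF finA] A(2) by metis
  \<comment> \<open>Labels start at 1, whereas the enumeration of the image starts at 0.\<close>
  define e where "e = (\<lambda>j. h (j - 1))"
  have e: "bij_betw e {1..?k} A"
  proof -
    have "bij_betw (\<lambda>j. j - 1) {1..?k} {..<?k}"
      by (rule bij_betw_byWitness[where f' = Suc]) auto
    from bij_betw_trans[OF this h(1)] show ?thesis by (simp add: e_def comp_def)
  qed
  have e_mono: "strict_mono_on {1..?k} e"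
    using h(2) by (auto simp: e_def strict_mono_on_def monotone_on_def)
  define g where "g = the_inv_into {1..?k} e"
  have inj_e: "inj_on e {1..?k}" and e_img: "e ` {1..?k} = A" using e by (auto simp: bij_betw_def)
  have ge: "g (e j) = j" if "j \<in> {1..?k}" for j
    unfolding g_def using the_inv_into_f_f[OF inj_e that] .
  have eg: "e (g a) = a" "g a \<in> {1..?k}" if "a \<in> A" for a
    using that e_img ge by auto
  have onto: "L ` D = {1..?k}" if "L \<in> inj_labellings D Q ?k" for L
    using that fin by (intro card_subset_eq) (auto simp: inj_labellings_def card_image)
  have "bij_betw (\<lambda>L. restrict (e \<circ> L) D) (inj_labellings D Q ?k) {L \<in> inj_labellings D Q N. L ` D = A}"
  proof (rule bij_betw_byWitness[where f' = "\<lambda>L. restrict (g \<circ> L) D"])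
    show "(\<lambda>L. restrict (e \<circ> L) D) ` inj_labellings D Q ?k \<subseteq> {L \<in> inj_labellings D Q N. L ` D = A}"
    proof (intro image_subsetI)
      fix L assume L: "L \<in> inj_labellings D Q ?k"
      have img: "restrict (e \<circ> L) D ` D = A"
        using onto[OF L] e_img image_image[of e L D] by simp
      have "inj_on (e \<circ> L) D"
        using L onto[OF L] inj_e by (intro comp_inj_on) (auto simp: inj_labellings_def)
      moreover have "Q (restrict (e \<circ> L) D) \<longleftrightarrow> Q (e \<circ> L)" by (rule cong) simp
      moreover have "Q (e \<circ> L) \<longleftrightarrow> Q L" using e_mono onto[OF L] by (intro mono) simp
      ultimately show "restrict (e \<circ> L) D \<in> {L \<in> inj_labellings D Q N. L ` D = A}"
        using L img A(1) by (auto simp: inj_labellings_def PiE_iff inj_on_def)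
    qed
    show "(\<lambda>L. restrict (g \<circ> L) D) ` {L \<in> inj_labellings D Q N. L ` D = A} \<subseteq> inj_labellings D Q ?k"
    proof (intro image_subsetI)
      fix L assume L: "L \<in> {L \<in> inj_labellings D Q N. L ` D = A}"
      then have LA: "L x \<in> A" if "x \<in> D" for x using that by auto
      have "inj_on g A" using eg(1) by (rule inj_on_inverseI)
      then have "inj_on (g \<circ> L) D"
        using L by (intro comp_inj_on) (auto simp: inj_labellings_def)
      moreover have "Q (restrict (g \<circ> L) D) \<longleftrightarrow> Q (g \<circ> L)" by (rule cong) simp
      moreover have "Q (e \<circ> (g \<circ> L)) \<longleftrightarrow> Q (g \<circ> L)"
      proof (rule mono)
        have "(g \<circ> L) ` D \<subseteq> {1..?k}" using eg(2) LA by auto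
        with e_mono show "strict_mono_on ((g \<circ> L) ` D) e"
          by (rule monotone_on_subset)
      qed
      moreover have "Q (e \<circ> (g \<circ> L)) \<longleftrightarrow> Q L" by (rule cong) (simp add: eg(1) LA)
      moreover have "Q L" using L by (simp add: inj_labellings_def)
      ultimately show "restrict (g \<circ> L) D \<in> inj_labellings D Q ?k"
        using eg(2) LA by (auto simp: inj_labellings_def PiE_iff inj_on_def)
    qed
    show "\<forall>L\<in>inj_labellings D Q ?k. restrict (g \<circ> restrict (e \<circ> L) D) D = L"
    proof
      fix L assume L: "L \<in> inj_labellings D Q ?k"
      then have "L \<in> D \<rightarrow>\<^sub>E {1..?k}" by (simp add: inj_labellings_def)
      then show "restrict (g \<circ> restrict (e \<circ> L) D) D = L"
        by (intro extensionalityI[of _ D]) (auto simp: PiE_iff ge)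
    qed
    show "\<forall>L\<in>{L \<in> inj_labellings D Q N. L ` D = A}. restrict (e \<circ> restrict (g \<circ> L) D) D = L"
    proof
      fix L assume L: "L \<in> {L \<in> inj_labellings D Q N. L ` D = A}"
      then have "L \<in> D \<rightarrow>\<^sub>E {1..N}" "\<And>x. x \<in> D \<Longrightarrow> L x \<in> A"
        by (auto simp: inj_labellings_def)
      then show "restrict (e \<circ> restrict (g \<circ> L) D) D = L"
        by (intro extensionalityI[of _ D]) (simp_all add: PiE_iff eg(1))
    qed
  qed
  from bij_betw_same_card[OF this] show ?thesis by (rule sym)
qed

lemma finite_inj_labellings: "finite D \<Longrightarrow> finite (inj_labellings D Q N)"
  by (rule finite_subset[of _ "D \<rightarrow>\<^sub>E {1..N}"]) (auto simp: inj_labellings_def intro: finite_PiE)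

lemma card_inj_labellings:
  fixes Q :: "('a \<Rightarrow> nat) \<Rightarrow> bool"
  assumes fin: "finite D"
    and cong: "\<And>L L'. (\<And>x. x \<in> D \<Longrightarrow> L x = L' x) \<Longrightarrow> Q L \<longleftrightarrow> Q L'"
    and mono: "\<And>L f. strict_mono_on (L ` D) f \<Longrightarrow> Q (f \<circ> L) \<longleftrightarrow> Q L"
  shows "card (inj_labellings D Q N) = (N choose card D) * card (inj_labellings D Q (card D))"
proof -
  let ?X = "{A. A \<subseteq> {1..N} \<and> card A = card D}"
  have "inj_labellings D Q N = (\<Union>A\<in>?X. {L \<in> inj_labellings D Q N. L ` D = A})"
    by (auto simp: inj_labellings_def card_image)
  also have "card \<dots> = (\<Sum>A\<in>?X. card {L \<in> inj_labellings D Q N. L ` D = A})"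
    by (rule card_UN_disjoint) (auto intro: finite_subset[OF _ finite_inj_labellings[OF fin]])
  also have "\<dots> = (\<Sum>A\<in>?X. card (inj_labellings D Q (card D)))"
    by (intro sum.cong refl) (simp add: card_inj_labellings_onto[OF fin cong mono])
  also have "\<dots> = (N choose card D) * card (inj_labellings D Q (card D))"
    using n_subsets[of "{1..N}" "card D"] by simp
  finally show ?thesis .
qed

text \<open>There are \<open>N choose k\<close> possible images of an injective labeling, and \<open>N choose k\<close> divided by
\<open>N ^ k\<close> tends to \<open>1 / k!\<close>. Labelings that are not injective form a vanishing fraction of all
\<open>N ^ k\<close> labelings, so they contribute nothing to the limit.\<close>

lemma labellings_limit:
  fixes Q :: "('a \<Rightarrow> nat) \<Rightarrow> bool"
  assumes fin: "finite D"
    and cong: "\<And>L L'. (\<And>x. x \<in> D \<Longrightarrow> L x = L' x) \<Longrightarrow> Q L \<longleftrightarrow> Q L'"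
    and mono: "\<And>L f. strict_mono_on (L ` D) f \<Longrightarrow> Q (f \<circ> L) \<longleftrightarrow> Q L"
  shows "(\<lambda>N. card {L \<in> D \<rightarrow>\<^sub>E {1..N}. Q L} / real N ^ card D)
    \<longlonglongrightarrow> card (inj_labellings D Q (card D)) / fact (card D)"
proof -
  let ?k = "card D"
  define c where "c = (\<lambda>N. card (inj_labellings D (\<lambda>_. True) N))"
  have c_prod: "c N = (\<Prod>i = 0..<?k. N - i)" for N
    using card_inj_on_subset_funcset[of D "{1..N}" D] fin by (simp add: c_def inj_labellings_def)
  have c_k: "real (c ?k) = fact ?k"
    unfolding c_prod fact_prod_rev[of ?k] by simp
  have c_choose: "c N = (N choose ?k) * c ?k" for N
    unfolding c_def by (rule card_inj_labellings) (use fin in auto)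
  have lim_c: "(\<lambda>N. c N / real N ^ ?k) \<longlonglongrightarrow> 1"
  proof -
    have "(\<lambda>N. \<Prod>i = 0..<?k. 1 - real i / real N) \<longlonglongrightarrow> (\<Prod>i = 0..<?k. 1 - 0)"
      by (intro tendsto_prod tendsto_diff tendsto_const lim_const_over_n)
    moreover have "\<forall>\<^sub>F N in sequentially. (\<Prod>i = 0..<?k. 1 - real i / real N) = c N / real N ^ ?k"
      using eventually_ge_at_top[of "Suc ?k"]
    proof eventually_elim
      case (elim N)
      have "(\<Prod>i = 0..<?k. 1 - real i / real N) = (\<Prod>i = 0..<?k. real (N - i) / real N)"
        using elim by (intro prod.cong refl) (auto simp: of_nat_diff diff_divide_distrib)
      also have "\<dots> = c N / real N ^ ?k" by (simp add: prod_dividef c_prod)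
      finally show ?case .
    qed
    ultimately show ?thesis by (simp add: tendsto_cong)
  qed
  \<comment> \<open>Here \<open>c N\<close> counts all injective labelings, so that \<open>c ?k\<close> is \<open>fact ?k\<close>.\<close>
  let ?b = "card (inj_labellings D Q ?k)"
  have inj_eq: "card (inj_labellings D Q N) / real N ^ ?k = c N / real N ^ ?k * (?b / fact ?k)" for N
  proof -
    have "card (inj_labellings D Q N) = (N choose ?k) * ?b"
      using fin cong mono by (rule card_inj_labellings)
    then show ?thesis unfolding c_choose[of N] of_nat_mult c_k by simp
  qed
  have lim_inj: "(\<lambda>N. card (inj_labellings D Q N) / real N ^ ?k) \<longlonglongrightarrow> ?b / fact ?k"
    unfolding inj_eq using tendsto_mult_right[OF lim_c, of "?b / fact ?k"] by simp
  let ?r = "\<lambda>N. card {L \<in> D \<rightarrow>\<^sub>E {1..N}. Q L \<and> \<not> inj_on L D} / real N ^ ?k"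
  have lim_r: "?r \<longlonglongrightarrow> 0"
  proof (rule tendsto_sandwich)
    show "\<forall>\<^sub>F N in sequentially. 0 \<le> ?r N" by simp
    show "\<forall>\<^sub>F N in sequentially. ?r N \<le> 1 - c N / real N ^ ?k"
      using eventually_gt_at_top[of 0]
    proof eventually_elim
      case (elim N)
      have finE: "finite (D \<rightarrow>\<^sub>E {1..N})" using fin by (simp add: finite_PiE)
      have cardE: "card (D \<rightarrow>\<^sub>E {1..N}) = N ^ ?k"
        using card_funcsetE[OF fin, of "{1..N}"] by simp
      have sub: "inj_labellings D (\<lambda>_. True) N \<subseteq> D \<rightarrow>\<^sub>E {1..N}"
        by (auto simp: inj_labellings_def)
      have "card {L \<in> D \<rightarrow>\<^sub>E {1..N}. Q L \<and> \<not> inj_on L D} \<le>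
          card ((D \<rightarrow>\<^sub>E {1..N}) - inj_labellings D (\<lambda>_. True) N)"
        by (rule card_mono) (use finE in \<open>auto simp: inj_labellings_def\<close>)
      also have "\<dots> = N ^ ?k - c N"
        using card_Diff_subset[OF finite_inj_labellings[OF fin] sub] by (simp only: c_def cardE)
      finally have "card {L \<in> D \<rightarrow>\<^sub>E {1..N}. Q L \<and> \<not> inj_on L D} + c N \<le> N ^ ?k"
        using card_mono[OF finE sub] unfolding cardE c_def by linarith
      from of_nat_mono[where 'a = real, OF this]
      have "real (card {L \<in> D \<rightarrow>\<^sub>E {1..N}. Q L \<and> \<not> inj_on L D}) + real (c N) \<le> real N ^ ?k"
        by (simp only: of_nat_add of_nat_power)
      then show ?case using elim by (simp add: field_simps)
    qed
    show "(\<lambda>N. 1 - c N / real N ^ ?k) \<longlonglongrightarrow> 0"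
      using tendsto_diff[OF tendsto_const[of 1] lim_c] by simp
  qed simp
  have split: "card {L \<in> D \<rightarrow>\<^sub>E {1..N}. Q L} / real N ^ ?k =
      card (inj_labellings D Q N) / real N ^ ?k + ?r N" for N
  proof -
    have "{L \<in> D \<rightarrow>\<^sub>E {1..N}. Q L} =
        inj_labellings D Q N \<union> {L \<in> D \<rightarrow>\<^sub>E {1..N}. Q L \<and> \<not> inj_on L D}"
      by (auto simp: inj_labellings_def)
    moreover have "finite {L \<in> D \<rightarrow>\<^sub>E {1..N}. Q L \<and> \<not> inj_on L D}"
      by (rule finite_subset[of _ "D \<rightarrow>\<^sub>E {1..N}"]) (auto simp: fin finite_PiE)
    ultimately have "card {L \<in> D \<rightarrow>\<^sub>E {1..N}. Q L} =
        card (inj_labellings D Q N) + card {L \<in> D \<rightarrow>\<^sub>E {1..N}. Q L \<and> \<not> inj_on L D}"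
      using finite_inj_labellings[OF fin] by (simp add: card_Un_disjoint inj_labellings_def disjoint_iff)
    then show ?thesis by (simp add: add_divide_distrib)
  qed
  show ?thesis unfolding split using tendsto_add[OF lim_inj lim_r] by simp
qed

section \<open>Ordered partitions as labelings, and the limit\<close>

lemma block_label_bij:
  assumes "distinct Bs"
  shows "block_label Bs ` set Bs \<subseteq> {1..length Bs}" "inj_on (block_label Bs) (set Bs)"
    "i < length Bs \<Longrightarrow> block_label Bs (Bs ! i) = Suc i"
proof -
  show lab: "block_label Bs (Bs ! i) = Suc i" if "i < length Bs" for i
    using block_label_nth[OF assms, of "Suc i"] that by simp
  show "block_label Bs ` set Bs \<subseteq> {1..length Bs}" by (auto simp: in_set_conv_nth lab)
  show "inj_on (block_label Bs) (set Bs)" by (auto simp: inj_on_def in_set_conv_nth lab)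
qed

text \<open>An ordered partition is a partition together with a bijective labeling by positions; an injective
labeling of \<open>k\<close> blocks by \<open>{1..k}\<close> is bijective.\<close>

lemma card_OV2plus:
  "card (OV2plus n k) =
    (\<Sum>P\<in>{P \<in> NC2plus n. card P = k}. card (inj_labellings P (v_monotone P) k))"
proof -
  let ?X = "{P \<in> NC2plus n. card P = k}"
  let ?S = "SIGMA P:?X. inj_labellings P (v_monotone P) k"
  have finX: "finite ?X" using finite_NC2plus[of n] by simp
  have "bij_betw (\<lambda>Bs. (set Bs, restrict (block_label Bs) (set Bs))) (OV2plus n k) ?S"
  proof (rule bij_betw_byWitness[where f' = "\<lambda>(P, L). map (the_inv_into P L) [1..<Suc k]"])
    show "(\<lambda>Bs. (set Bs, restrict (block_label Bs) (set Bs))) ` OV2plus n k \<subseteq> ?S"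
    proof (intro image_subsetI)
      fix Bs assume Bs: "Bs \<in> OV2plus n k"
      then have d: "distinct Bs" "length Bs = k" by (auto simp: OV2plus_def)
      have "v_monotone (set Bs) (restrict (block_label Bs) (set Bs)) \<longleftrightarrow>
          v_monotone (set Bs) (block_label Bs)"
        by (rule v_monotone_cong) simp
      then show "(set Bs, restrict (block_label Bs) (set Bs)) \<in> ?S"
        using Bs block_label_bij(1,2)[OF d(1)] d distinct_card[OF d(1)]
        by (auto simp: OV2plus_def inj_labellings_def inj_on_def)
    qed
    show "\<forall>Bs\<in>OV2plus n k. (case (set Bs, restrict (block_label Bs) (set Bs)) of
        (P, L) \<Rightarrow> map (the_inv_into P L) [1..<Suc k]) = Bs"
    proof
      fix Bs assume Bs: "Bs \<in> OV2plus n k"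
      then have d: "distinct Bs" "length Bs = k" by (auto simp: OV2plus_def)
      have "map (the_inv_into (set Bs) (restrict (block_label Bs) (set Bs))) [1..<Suc k] = Bs"
      proof (rule nth_equalityI)
        fix i assume "i < length (map (the_inv_into (set Bs) (restrict (block_label Bs) (set Bs))) [1..<Suc k])"
        then have i: "i < k" by (simp del: upt_Suc)
        have "the_inv_into (set Bs) (restrict (block_label Bs) (set Bs)) (Suc i) = Bs ! i"
          using block_label_bij(2,3)[OF d(1)] i d(2)
          by (intro the_inv_into_f_eq) (auto simp: inj_on_def)
        then show "map (the_inv_into (set Bs) (restrict (block_label Bs) (set Bs))) [1..<Suc k] ! i = Bs ! i"
          using i by (simp del: upt_Suc)
      qed (simp add: d(2) del: upt_Suc)
      then show "(case (set Bs, restrict (block_label Bs) (set Bs)) of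
        (P, L) \<Rightarrow> map (the_inv_into P L) [1..<Suc k]) = Bs" by simp
    qed
    have inverse: "map (the_inv_into P L) [1..<Suc k] \<in> OV2plus n k \<and>
        set (map (the_inv_into P L) [1..<Suc k]) = P \<and>
        restrict (block_label (map (the_inv_into P L) [1..<Suc k])) P = L"
      if P: "P \<in> ?X" and L: "L \<in> inj_labellings P (v_monotone P) k" for P L
    proof -
      let ?Bs = "map (the_inv_into P L) [1..<Suc k]"
      have inj: "inj_on L P" and ext: "L \<in> P \<rightarrow>\<^sub>E {1..k}" using L by (auto simp: inj_labellings_def)
      have img: "L ` P = {1..k}"
        using P inj ext by (intro card_subset_eq) (auto simp: card_image)
      have setBs: "set ?Bs = P"
        using the_inv_into_onto[OF inj] by (simp add: img atLeastLessThanSuc_atLeastAtMost del: upt_Suc)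
      have dBs: "distinct ?Bs"
        using inj_on_the_inv_into[OF inj]
        by (simp add: distinct_map img atLeastLessThanSuc_atLeastAtMost del: upt_Suc)
      have lab: "block_label ?Bs B = L B" if B: "B \<in> P" for B
      proof -
        have LB: "L B \<in> {1..k}" using img B by blast
        then have "[1..<Suc k] ! (L B - 1) = L B" "L B - 1 < length [1..<Suc k]"
          by (auto simp del: upt_Suc)
        then have "?Bs ! (L B - 1) = B"
          by (simp only: nth_map the_inv_into_f_f[OF inj B])
        then show ?thesis using block_label_nth[OF dBs, of "L B"] LB by (simp del: upt_Suc)
      qed
      have "v_monotone P (block_label ?Bs) \<longleftrightarrow> v_monotone P L"
        by (rule v_monotone_cong) (rule lab)
      then have "?Bs \<in> OV2plus n k"
        using P L setBs dBs by (simp add: OV2plus_def inj_labellings_def del: upt_Suc)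
      moreover have "restrict (block_label ?Bs) P = L"
        using lab ext by (auto simp: fun_eq_iff PiE_iff extensional_def simp del: upt_Suc)
      ultimately show ?thesis using setBs by blast
    qed
    show "\<forall>x\<in>?S. (set (case x of (P, L) \<Rightarrow> map (the_inv_into P L) [1..<Suc k]),
        restrict (block_label (case x of (P, L) \<Rightarrow> map (the_inv_into P L) [1..<Suc k]))
          (set (case x of (P, L) \<Rightarrow> map (the_inv_into P L) [1..<Suc k]))) = x"
      using inverse by (auto simp del: upt_Suc set_map set_upt)
    show "(\<lambda>(P, L). map (the_inv_into P L) [1..<Suc k]) ` ?S \<subseteq> OV2plus n k"
      using inverse by (auto simp del: upt_Suc)
  qed
  then have "card (OV2plus n k) = card ?S" by (rule bij_betw_same_card)
  also have "\<dots> = (\<Sum>P\<in>?X. card (inj_labellings P (v_monotone P) k))"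
  proof (rule card_SigmaI[OF finX])
    show "\<forall>P\<in>?X. finite (inj_labellings P (v_monotone P) k)"
      by (auto intro!: finite_inj_labellings dest: finite_nc)
  qed
  finally show ?thesis .
qed

theorem theorem4p11:
  fixes n :: nat and lam :: real
  shows "(\<lambda>N. vacuum_state (S_op N lam ^^ n)) \<longlonglongrightarrow>
    complex_of_real
      (\<Sum>k = 0..n div 2. real (card (OV2plus n k)) / fact k * lam ^ (n - 2 * k))"
proof -
  let ?I = "\<lambda>P. card (inj_labellings P (v_monotone P) (card P))"
  have "(\<lambda>N. \<Sum>P\<in>NC2plus n. card (v_labels N (P, [])) / real N ^ card P * lam ^ (n - 2 * card P))
      \<longlonglongrightarrow> (\<Sum>P\<in>NC2plus n. ?I P / fact (card P) * lam ^ (n - 2 * card P))"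
  proof (intro tendsto_sum tendsto_mult_right)
    fix P assume P: "P \<in> NC2plus n"
    show "(\<lambda>N. card (v_labels N (P, [])) / real N ^ card P) \<longlonglongrightarrow> ?I P / fact (card P)"
      unfolding card_v_labels_closed[OF P]
      by (rule labellings_limit[OF finite_nc[OF P] v_monotone_cong v_monotone_strict_mono])
  qed
  also have "(\<Sum>P\<in>NC2plus n. ?I P / fact (card P) * lam ^ (n - 2 * card P)) =
      (\<Sum>k = 0..n div 2. \<Sum>P\<in>{P \<in> NC2plus n. card P = k}. ?I P / fact (card P) * lam ^ (n - 2 * card P))"
  proof (rule sum.group[symmetric])
    have "2 * card P \<le> n" if "P \<in> NC2plus n" for P
      using points_used_le[of "(P, [])" n] that by (simp add: configs_closed_iff)
    then show "card ` NC2plus n \<subseteq> {0..n div 2}" by fastforce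
  qed (use finite_NC2plus in auto)
  also have "\<dots> = (\<Sum>k = 0..n div 2. real (card (OV2plus n k)) / fact k * lam ^ (n - 2 * k))"
    unfolding card_OV2plus by (simp add: sum_distrib_right sum_divide_distrib)
  finally show ?thesis unfolding vacuum_moment by (rule tendsto_of_real)
qed

end
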